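(* Let $N\ge 1$ and let $s$ be an integer with $2^{N+1}<s\le 5\cdot 2^{N-1}$. Then there is a bitrade of cardinality $s$ in $Q_3^N$ if and only if there exist integers $n\ge 1$ and $m\ge 0$ with $N=n+m$ such that at least one of the following holds: (i) $n\ge 4$ and $s=2^m\left(\frac52\cdot 2^n-6\right)$; (ii) $n=5$ and $s=2^m\left(\frac52\cdot 2^5-2\right)$; (iii) $n=3$ and $s=2^m\left(\frac52\cdot 2^3-2\right)$; (iv) $n=4$ and $s=2^m\left(\frac52\cdot 2^4\right)$.
   Context: $Q_3$ is a set of $3$ symbols. A one-dimensional face of $Q_3^N$ is a set of $3$ words obtained by fixing the values of all coordinates but one. A unitrade is a set $U\subset Q_3^N$ whose intersection with every one-dimensional face has cardinality $0$ or $2$. The Hamming graph on $Q_3^N$ joins two words when they differ in exactly one coordinate. A bitrade is a unitrade $U$ such that the subgraph of the Hamming graph induced by $U$ is bipartite. *)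

theory Defs
  imports Complex_Main "Graph_Theory.Digraph_Component"
begin

definition words :: "'a set \<Rightarrow> nat \<Rightarrow> 'a list set" where
  "words Q N = {w. set w \<subseteq> Q \<and> length w = N}"

definition line :: "'a set \<Rightarrow> nat \<Rightarrow> nat \<Rightarrow> 'a list \<Rightarrow> 'a list set" where
  "line Q N i x = {y \<in> words Q N. \<forall>j<N. j \<noteq> i \<longrightarrow> y ! j = x ! j}"

definition one_dim_faces :: "'a set \<Rightarrow> nat \<Rightarrow> 'a list set set" where
  "one_dim_faces Q N = {line Q N i x | i x. i < N \<and> x \<in> words Q N}"

definition unitrade :: "'a set \<Rightarrow> nat \<Rightarrow> 'a list set \<Rightarrow> bool" where
  "unitrade Q N U \<longleftrightarrow> U \<subseteq> words Q N \<and> (\<forall>F \<in> one_dim_faces Q N. card (U \<inter> F) \<in> {0, 2})"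

(* An undirected graph is represented, as in the Graph_Theory library, by a digraph with a
   symmetric arc set; an arc is the ordered pair of its ends. *)
definition hamming_graph :: "'a set \<Rightarrow> nat \<Rightarrow> ('a list, 'a list \<times> 'a list) pre_digraph" where
  "hamming_graph Q N =
     \<lparr>verts = words Q N,
      arcs = {(x, y). x \<in> words Q N \<and> y \<in> words Q N \<and> card {i. i < N \<and> x ! i \<noteq> y ! i} = 1},
      tail = fst, head = snd\<rparr>"

definition bipartite :: "('a, 'b) pre_digraph \<Rightarrow> bool" where
  "bipartite G \<longleftrightarrow>
     (\<exists>A B. A \<union> B = verts G \<and> A \<inter> B = {} \<and>
        (\<forall>e \<in> arcs G. tail G e \<in> A \<and> head G e \<in> B \<or> tail G e \<in> B \<and> head G e \<in> A))"

definition bitrade :: "'a set \<Rightarrow> nat \<Rightarrow> 'a list set \<Rightarrow> bool" where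
  "bitrade Q N U \<longleftrightarrow> unitrade Q N U \<and> bipartite (hamming_graph Q N \<restriction> U)"

end

(* A bitrade is the support of a function on words with values in {-1, 0, 1} whose sum over every line
   is 0; its layers in a direction are again such functions and add up to 0.  Comparing the three layers,
   a support of size less than 2^(n+1) is empty, a box (a product of 2-subsets of Q), or the symmetric
   difference of two boxes.  Let 2^(n+1) < s < 5/2 2^n.  If some coordinate misses a value, s is twice a
   size in dimension n-1.  Otherwise the smallest layer is a box or has relative size 3/2.  If it is a
   box, the support is the symmetric difference of three boxes and s is given by inclusion-exclusion;
   if not, two layers have relative size 3/2 and the third is again small, which leaves the sizes
   5/2 2^n - 2^j.  The superfluous values are excluded since s is 0 or 2^n modulo 3, both for the
   bitrade and for its faces, and, for small j, since two layers without a common constant coordinate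
   cannot overlap much. *)

theory Submission
  imports Defs
begin

section \<open>Signed bitrades\<close>

text \<open>Signs are carried along because the residue modulo 3 is an invariant of zero-sum
  functions; the arguments with boxes only use that, modulo 2, one layer is the sum of the other
  two. The thresholds come from relative sizes. A small support in dimension n has size (2 -
  2^(1-d)) * 2^n, that is 0, 1, 3/2, 7/4, ... times 2^n. The smallest of three layers with total
  below 5 * 2^n is below 5/3, so it can only be 1 or 3/2; once two layers are 3/2, the third is
  below 2 and is classified as well. At total 5 this breaks down: layers 3/2, 7/4, 7/4 do occur
  (\<open>tree_size_40\<close>), so the endpoint is settled by a construction and, in low dimension,
  by a crude upper bound. Among the candidates left by three small layers, the residue modulo 3
  removes only every second one; the overlap bound is what cuts off the infinite tail.\<close>

definition zero_sum :: "'a set \<Rightarrow> nat \<Rightarrow> ('a list \<Rightarrow> int) \<Rightarrow> bool" where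
  "zero_sum Q n f \<longleftrightarrow> (\<forall>w \<in> words Q n. \<forall>i<n. (\<Sum>q\<in>Q. f (w[i := q])) = 0)"

definition signed :: "'a set \<Rightarrow> nat \<Rightarrow> ('a list \<Rightarrow> int) \<Rightarrow> bool" where
  "signed Q n f \<longleftrightarrow> zero_sum Q n f \<and> (\<forall>w \<in> words Q n. f w \<in> {-1, 0, 1})"

definition supp :: "'a set \<Rightarrow> nat \<Rightarrow> ('a list \<Rightarrow> int) \<Rightarrow> 'a list set" where
  "supp Q n f = {w \<in> words Q n. f w \<noteq> 0}"

lemma words_0 [simp]: "words Q 0 = {[]}"
  by (auto simp: words_def)

lemma Cons_in_words [simp]: "x # w \<in> words Q (Suc n) \<longleftrightarrow> x \<in> Q \<and> w \<in> words Q n"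
  by (auto simp: words_def)

lemma words_Suc: "words Q (Suc n) = (\<lambda>(x, w). x # w) ` (Q \<times> words Q n)"
  by (force simp: words_def length_Suc_conv image_iff)

lemma words_SucE:
  assumes "w \<in> words Q (Suc n)"
  obtains x w' where "w = x # w'" "x \<in> Q" "w' \<in> words Q n"
  using assms by (auto simp: words_Suc)

lemma finite_words [simp]: "finite Q \<Longrightarrow> finite (words Q n)"
  by (induction n) (simp_all add: words_Suc)

lemma finite_supp [simp]: "finite Q \<Longrightarrow> finite (supp Q n f)"
  by (simp add: supp_def)

lemma update_in_words: "w \<in> words Q n \<Longrightarrow> q \<in> Q \<Longrightarrow> w[i := q] \<in> words Q n"
  unfolding words_def using set_update_subset_insert[of w i q] by auto

lemma Cons_in_supp [simp]: "x # w \<in> supp Q (Suc n) f \<longleftrightarrow> x \<in> Q \<and> w \<in> supp Q n (\<lambda>w. f (x # w))"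
  by (auto simp: supp_def)

lemma sum_words_Suc:
  "(\<Sum>w\<in>words Q (Suc n). g w) = (\<Sum>q\<in>Q. \<Sum>w\<in>words Q n. g (q # w))"
proof -
  have "inj_on (\<lambda>(x, w). x # w) (Q \<times> words Q n)"
    by (auto simp: inj_on_def)
  then have "(\<Sum>w\<in>words Q (Suc n). g w) = (\<Sum>(q, w)\<in>Q \<times> words Q n. g (q # w))"
    by (simp add: words_Suc sum.reindex case_prod_unfold)
  then show ?thesis
    by (simp add: sum.cartesian_product)
qed

lemma supp_Suc: "supp Q (Suc n) f = (\<Union>q\<in>Q. Cons q ` supp Q n (\<lambda>w. f (q # w)))"
  by (auto simp: supp_def words_Suc)

lemma card_supp_Suc:
  assumes "finite Q"
  shows "card (supp Q (Suc n) f) = (\<Sum>q\<in>Q. card (supp Q n (\<lambda>w. f (q # w))))"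
proof -
  have "card (supp Q (Suc n) f) = (\<Sum>q\<in>Q. card (Cons q ` supp Q n (\<lambda>w. f (q # w))))"
    unfolding supp_Suc by (rule card_UN_disjoint) (use assms in auto)
  then show ?thesis
    by (simp add: card_image)
qed

lemma zero_sum_layer:
  assumes "zero_sum Q (Suc n) f" "x \<in> Q"
  shows "zero_sum Q n (\<lambda>w. f (x # w))"
  unfolding zero_sum_def
proof (intro ballI allI impI)
  fix w i assume "w \<in> words Q n" "i < n"
  then have "(\<Sum>q\<in>Q. f ((x # w)[Suc i := q])) = 0"
    using assms unfolding zero_sum_def by (metis Cons_in_words Suc_less_eq)
  then show "(\<Sum>q\<in>Q. f (x # w[i := q])) = 0"
    by simp
qed

lemma signed_layer:
  assumes "signed Q (Suc n) f" "x \<in> Q"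
  shows "signed Q n (\<lambda>w. f (x # w))"
  using assms zero_sum_layer[of Q n f x] by (auto simp: signed_def)

lemma zero_sum_head:
  assumes "zero_sum Q (Suc n) f" "w \<in> words Q n"
  shows "(\<Sum>q\<in>Q. f (q # w)) = 0"
\<comment> \<open>The line in direction 0 is the line of some word of length n + 1, so an arbitrary
  first letter is needed.\<close>
proof (cases "Q = {}")
  case False
  then obtain x where "x \<in> Q" by auto
  with assms have "(\<Sum>q\<in>Q. f ((x # w)[0 := q])) = 0"
    unfolding zero_sum_def by (metis Cons_in_words zero_less_Suc)
  then show ?thesis by simp
qed simp

lemma card_3_obtain:
  assumes "card Q = 3"
  obtains p q r where "Q = {p, q, r}" "p \<noteq> q" "p \<noteq> r" "q \<noteq> r"
  using assms by (auto simp: card_3_iff)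

section \<open>Support sizes modulo 3\<close>

lemma card_supp_eq_sum_squares:
  assumes "finite Q" "signed Q n f"
  shows "int (card (supp Q n f)) = (\<Sum>w\<in>words Q n. (f w)\<^sup>2)"
proof -
  have supp_eq: "supp Q n f = words Q n \<inter> {w. f w \<noteq> 0}"
    by (auto simp: supp_def)
  have "(\<Sum>w\<in>words Q n. (f w)\<^sup>2) = (\<Sum>w\<in>words Q n. if f w \<noteq> 0 then 1 else 0)"
    using assms(2) by (intro sum.cong) (auto simp: signed_def)
  also have "\<dots> = int (card (supp Q n f))"
    using assms(1) by (simp add: sum.If_cases supp_eq)
  finally show ?thesis by simp
qed

text \<open>Modulo 3, a line with values \<open>a\<close>, \<open>b\<close>, \<open>-a-b\<close> has square sum \<open>2(a-b)\<^sup>2\<close>, and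
  \<open>a-b\<close> is again a zero-sum function, one dimension lower.\<close>

lemma sum_squares_mod_3:
  assumes Q: "card Q = 3" and "zero_sum Q n f"
  shows "\<exists>c. (\<Sum>w\<in>words Q n. (f w)\<^sup>2) mod 3 = (2 ^ n * c\<^sup>2) mod (3::int)"
  using assms(2)
proof (induction n arbitrary: f)
  case 0
  show ?case by auto
next
  case (Suc n)
  obtain p q r where pqr: "Q = {p, q, r}" "p \<noteq> q" "p \<noteq> r" "q \<noteq> r"
    using card_3_obtain[OF Q] .
  define g where "g = (\<lambda>w. f (p # w) - f (q # w))"
  have "zero_sum Q n g"
    using zero_sum_layer[OF Suc.prems, of p] zero_sum_layer[OF Suc.prems, of q] pqr(1)
    unfolding zero_sum_def g_def sum_subtractf by auto
  then obtain c where c: "(\<Sum>w\<in>words Q n. (g w)\<^sup>2) mod 3 = (2 ^ n * c\<^sup>2) mod 3"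
    using Suc.IH by blast
  have square: "(\<Sum>x\<in>Q. (f (x # w))\<^sup>2) = 2 * (g w)\<^sup>2 + 3 * (2 * f (p # w) * f (q # w))"
    if "w \<in> words Q n" for w
  proof -
    have "f (p # w) + f (q # w) + f (r # w) = 0"
      using zero_sum_head[OF Suc.prems that] pqr by (simp add: add.assoc)
    then have r: "f (r # w) = - f (p # w) - f (q # w)" by simp
    have "(\<Sum>x\<in>Q. (f (x # w))\<^sup>2) = (f (p # w))\<^sup>2 + (f (q # w))\<^sup>2 + (f (r # w))\<^sup>2"
      using pqr by simp
    then show ?thesis
      unfolding r g_def by (simp add: power2_eq_square algebra_simps)
  qed
  have "(\<Sum>w\<in>words Q (Suc n). (f w)\<^sup>2) = (\<Sum>w\<in>words Q n. \<Sum>x\<in>Q. (f (x # w))\<^sup>2)"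
    unfolding sum_words_Suc by (rule sum.swap)
  also have "\<dots> = 2 * (\<Sum>w\<in>words Q n. (g w)\<^sup>2) + 3 * (\<Sum>w\<in>words Q n. 2 * f (p # w) * f (q # w))"
    by (simp add: square sum.distrib sum_distrib_left cong: sum.cong)
  finally have "(\<Sum>w\<in>words Q (Suc n). (f w)\<^sup>2) mod 3 = 2 * (\<Sum>w\<in>words Q n. (g w)\<^sup>2) mod 3"
    by simp
  also have "\<dots> = 2 * (2 ^ n * c\<^sup>2) mod 3"
    using c by (metis mod_mult_right_eq)
  also have "\<dots> = (2 ^ Suc n * c\<^sup>2) mod 3"
    by (simp add: mult.assoc)
  finally show ?case by blast
qed

text \<open>For values in {-1, 0, 1} the sum of squares counts the support, and a square is 0 or 1
  modulo 3.\<close>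

lemma card_supp_mod_3:
  assumes Q: "card Q = 3" and "signed Q n f"
  shows "card (supp Q n f) mod 3 = 0 \<or> card (supp Q n f) mod 3 = 2 ^ n mod 3"
proof -
  have "finite Q" using Q by (metis card.infinite zero_neq_numeral)
  then have s: "int (card (supp Q n f)) = (\<Sum>w\<in>words Q n. (f w)\<^sup>2)"
    using card_supp_eq_sum_squares assms(2) by blast
  obtain c where c: "int (card (supp Q n f)) mod 3 = (2 ^ n * c\<^sup>2) mod 3"
    using sum_squares_mod_3[OF Q] assms(2) unfolding s signed_def by blast
  have "c mod 3 = 0 \<or> c mod 3 = 1 \<or> c mod 3 = 2" by presburger
  then have "c\<^sup>2 mod 3 = 0 \<or> c\<^sup>2 mod 3 = 1"
    by (auto simp: power2_eq_square mod_mult_eq[of c 3 c, symmetric])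
  then have "int (card (supp Q n f)) mod 3 = 0 \<or> int (card (supp Q n f)) mod 3 = 2 ^ n mod 3"
    unfolding c by (metis mod_mult_right_eq mult_zero_right mult.right_neutral mod_0)
  moreover have "int (card (supp Q n f)) mod 3 = int (card (supp Q n f) mod 3)"
    by (simp add: zmod_int)
  moreover have "(2 ^ n :: int) mod 3 = int (2 ^ n mod 3)"
    by (simp add: zmod_int)
  ultimately show ?thesis by linarith
qed

section \<open>Bitrades as supports\<close>

lemma line_eq:
  assumes "x \<in> words Q n" "i < n"
  shows "line Q n i x = (\<lambda>q. x[i := q]) ` Q"
proof
  show "line Q n i x \<subseteq> (\<lambda>q. x[i := q]) ` Q"
  proof
    fix y assume y: "y \<in> line Q n i x"
    then have "y = x[i := y ! i]"
      using assms by (intro nth_equalityI) (auto simp: line_def words_def nth_list_update)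
    moreover have "y ! i \<in> Q"
      using y assms by (auto simp: line_def words_def)
    ultimately show "y \<in> (\<lambda>q. x[i := q]) ` Q" by blast
  qed
  show "(\<lambda>q. x[i := q]) ` Q \<subseteq> line Q n i x"
    using assms update_in_words[of x Q n] by (auto simp: line_def)
qed

lemma inj_on_update: "x \<in> words Q n \<Longrightarrow> i < n \<Longrightarrow> inj_on (\<lambda>q. x[i := q]) Q"
  unfolding inj_on_def words_def by (metis (mono_tags, lifting) mem_Collect_eq nth_list_update_eq)

lemma card_Int_line:
  assumes "x \<in> words Q n" "i < n"
  shows "card (U \<inter> line Q n i x) = card {q \<in> Q. x[i := q] \<in> U}"
proof -
  have "U \<inter> line Q n i x = (\<lambda>q. x[i := q]) ` {q \<in> Q. x[i := q] \<in> U}"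
    unfolding line_eq[OF assms] by auto
  then show ?thesis
    using inj_on_update[OF assms] by (metis (no_types, lifting) card_image inj_on_subset mem_Collect_eq subsetI)
qed

lemma unitrade_iff:
  "unitrade Q n U \<longleftrightarrow> U \<subseteq> words Q n \<and>
     (\<forall>x \<in> words Q n. \<forall>i<n. card {q \<in> Q. x[i := q] \<in> U} \<in> {0, 2})"
  unfolding unitrade_def one_dim_faces_def using card_Int_line[of _ Q n _ U] by fastforce

lemma differ_once_iff:
  assumes "x \<in> words Q n" "y \<in> words Q n"
  shows "card {i. i < n \<and> x ! i \<noteq> y ! i} = 1 \<longleftrightarrow> (\<exists>i<n. \<exists>q\<in>Q. y = x[i := q] \<and> q \<noteq> x ! i)"
proof
  assume "card {i. i < n \<and> x ! i \<noteq> y ! i} = 1"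
  then obtain i where i: "{i. i < n \<and> x ! i \<noteq> y ! i} = {i}"
    by (meson card_1_singletonE)
  have *: "j < n \<and> x ! j \<noteq> y ! j \<longleftrightarrow> j = i" for j
    using i by (metis (mono_tags, lifting) mem_Collect_eq singletonD singletonI)
  then have yi: "i < n" "y ! i \<noteq> x ! i" by metis+
  have "x ! j = y ! j" if "j < n" "j \<noteq> i" for j
    using * that by metis
  then have "y = x[i := y ! i]"
    using assms yi by (intro nth_equalityI) (auto simp: words_def nth_list_update)
  moreover have "y ! i \<in> Q"
    using yi assms(2) by (auto simp: words_def)
  ultimately show "\<exists>i<n. \<exists>q\<in>Q. y = x[i := q] \<and> q \<noteq> x ! i" using yi by blast
next
  assume "\<exists>i<n. \<exists>q\<in>Q. y = x[i := q] \<and> q \<noteq> x ! i"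
  then obtain i q where "i < n" "y = x[i := q]" "q \<noteq> x ! i" by blast
  then have "{i. i < n \<and> x ! i \<noteq> y ! i} = {i}"
    using assms by (auto simp: words_def nth_list_update split: if_splits)
  then show "card {i. i < n \<and> x ! i \<noteq> y ! i} = 1" by simp
qed

text \<open>Adjacency becomes the update of one coordinate, the form in which lines enter
  \<open>unitrade_iff\<close> and \<open>zero_sum\<close>.\<close>

lemma bipartite_induced_iff:
  assumes "U \<subseteq> words Q n"
  shows "bipartite (hamming_graph Q n \<restriction> U) \<longleftrightarrow>
    (\<exists>A B. A \<union> B = U \<and> A \<inter> B = {} \<and>
      (\<forall>x\<in>U. \<forall>i<n. \<forall>q\<in>Q. x[i := q] \<in> U \<longrightarrow> q \<noteq> x ! i \<longrightarrow> (x \<in> A \<longleftrightarrow> x[i := q] \<in> B)))"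
    (is "?L \<longleftrightarrow> ?R")
proof -
  have arcs: "arcs (hamming_graph Q n \<restriction> U) =
      {(x, y). x \<in> U \<and> y \<in> U \<and> card {i. i < n \<and> x ! i \<noteq> y ! i} = 1}"
    using assms by (auto simp: hamming_graph_def)
  have ends: "verts (hamming_graph Q n \<restriction> U) = U" "tail (hamming_graph Q n \<restriction> U) = fst"
      "head (hamming_graph Q n \<restriction> U) = snd"
    by (simp_all add: hamming_graph_def)
  show ?thesis
  proof
    assume ?L
    then obtain A B where AB: "A \<union> B = U" "A \<inter> B = {}"
      and e: "\<forall>e \<in> {(x, y). x \<in> U \<and> y \<in> U \<and> card {i. i < n \<and> x ! i \<noteq> y ! i} = 1}.
        fst e \<in> A \<and> snd e \<in> B \<or> fst e \<in> B \<and> snd e \<in> A"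
      unfolding bipartite_def arcs ends by blast
    have *: "x \<in> A \<and> y \<in> B \<or> y \<in> A \<and> x \<in> B"
      if "x \<in> U" "y \<in> U" "card {i. i < n \<and> x ! i \<noteq> y ! i} = 1" for x y
      using bspec[OF e, of "(x, y)"] that by auto
    show ?R
    proof (intro exI conjI ballI allI impI)
      fix x i q assume "x \<in> U" "i < n" "q \<in> Q" "x[i := q] \<in> U" "q \<noteq> x ! i"
      then have "card {j. j < n \<and> x ! j \<noteq> x[i := q] ! j} = 1"
        using differ_once_iff[of x Q n "x[i := q]"] assms by (metis subsetD)
      then have "x \<in> A \<and> x[i := q] \<in> B \<or> x[i := q] \<in> A \<and> x \<in> B"
        using * \<open>x \<in> U\<close> \<open>x[i := q] \<in> U\<close> by blast
      then show "x \<in> A \<longleftrightarrow> x[i := q] \<in> B" using AB by blast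
    qed (use AB in auto)
  next
    assume ?R
    then obtain A B where AB: "A \<union> B = U" "A \<inter> B = {}"
      and step: "\<forall>x\<in>U. \<forall>i<n. \<forall>q\<in>Q. x[i := q] \<in> U \<longrightarrow> q \<noteq> x ! i \<longrightarrow> (x \<in> A \<longleftrightarrow> x[i := q] \<in> B)"
      by (elim exE conjE) (rule that)
    have "x \<in> A \<and> y \<in> B \<or> x \<in> B \<and> y \<in> A"
      if xy: "x \<in> U" "y \<in> U" "card {i. i < n \<and> x ! i \<noteq> y ! i} = 1" for x y
    proof -
      obtain i q where iq: "i < n" "q \<in> Q" "y = x[i := q]" "q \<noteq> x ! i"
        using xy differ_once_iff[of x Q n y] assms by (metis subsetD)
      have "x \<in> words Q n" using xy assms by blast
      \<comment> \<open>The condition is applied to the step from x to y and to the reverse step,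
        which handles a start in B.\<close>
      then have "x = y[i := x ! i]" "x ! i \<in> Q" "x ! i \<noteq> y ! i"
        using iq by (auto simp: words_def)
      then have "x \<in> A \<longleftrightarrow> y \<in> B" "y \<in> A \<longleftrightarrow> x \<in> B"
        using step iq xy(1,2) by metis+
      then show ?thesis using xy AB by blast
    qed
    then show ?L
      unfolding bipartite_def arcs ends using AB by (intro exI[of _ A] exI[of _ B]) auto
  qed
qed

text \<open>The colour classes become the values 1 and -1; the two words of U on a line are
  adjacent, so their values cancel.\<close>

lemma signed_of_bitrade:
  assumes Q: "card Q = 3" and U: "bitrade Q n U"
  obtains f where "signed Q n f" "supp Q n f = U"
proof -
  have UW: "U \<subseteq> words Q n"
    and U2: "\<And>x i. x \<in> words Q n \<Longrightarrow> i < n \<Longrightarrow> card {q \<in> Q. x[i := q] \<in> U} \<in> {0, 2}"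
    using U unfolding bitrade_def unitrade_iff by blast+
  obtain A B where AB: "A \<union> B = U" "A \<inter> B = {}"
    and *: "\<And>x i q. x \<in> U \<Longrightarrow> i < n \<Longrightarrow> q \<in> Q \<Longrightarrow> x[i := q] \<in> U \<Longrightarrow> q \<noteq> x ! i \<Longrightarrow>
      x \<in> A \<longleftrightarrow> x[i := q] \<in> B"
    using U UW bipartite_induced_iff unfolding bitrade_def by metis
  define f :: "'a list \<Rightarrow> int" where "f x = (if x \<in> A then 1 else if x \<in> B then -1 else 0)" for x
  have finQ: "finite Q" using Q by (metis card.infinite zero_neq_numeral)
  have "(\<Sum>q\<in>Q. f (x[i := q])) = 0" if xi: "x \<in> words Q n" "i < n" for x i
  proof -
    let ?S = "{q \<in> Q. x[i := q] \<in> U}"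
    have "(\<Sum>q\<in>Q. f (x[i := q])) = (\<Sum>q\<in>?S. f (x[i := q]))"
      by (rule sum.mono_neutral_right) (use finQ AB in \<open>auto simp: f_def\<close>)
    also have "\<dots> = 0"
    proof (cases "card ?S = 0")
      case True
      then have "?S = {}" using finQ by simp
      then show ?thesis by (simp only: sum.empty)
    next
      case False
      then have "card ?S = 2" using U2[OF xi] by auto
      then obtain a b where ab: "?S = {a, b}" "a \<noteq> b" by (meson card_2_iff)
      then have S: "a \<in> Q" "b \<in> Q" "x[i := a] \<in> U" "x[i := b] \<in> U" by auto
      have "x[i := a] ! i = a" using xi by (simp add: words_def)
      then have "x[i := a] \<in> A \<longleftrightarrow> x[i := b] \<in> B"
        using *[of "x[i := a]" i b] S ab(2) xi(2) by auto
      then show ?thesis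
        using ab S AB by (auto simp: f_def)
    qed
    finally show ?thesis .
  qed
  then have "signed Q n f" by (auto simp: signed_def zero_sum_def f_def)
  moreover have "supp Q n f = U" using AB UW by (auto simp: supp_def f_def)
  ultimately show thesis by (rule that)
qed

lemma sum_3_signs:
  fixes a b c :: int
  assumes "a \<in> {-1, 0, 1}" "b \<in> {-1, 0, 1}" "c \<in> {-1, 0, 1}" "a + b + c = 0" "a \<noteq> 0" "b \<noteq> 0"
  shows "a = - b"
  using assms by auto

text \<open>Three values in {-1, 0, 1} with sum 0 are all 0 or are 1, -1, 0 in some order. Hence a
  line meets the support in 0 or 2 words, and the sign is a proper colouring.\<close>

lemma bitrade_of_signed:
  assumes Q: "card Q = 3" and f: "signed Q n f"
  shows "bitrade Q n (supp Q n f)"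
proof -
  let ?U = "supp Q n f"
  have UW: "?U \<subseteq> words Q n" by (auto simp: supp_def)
  have val: "f x \<in> {-1, 0, 1}" if "x \<in> words Q n" for x
    using f that by (simp add: signed_def)
  have sum0: "(\<Sum>q\<in>Q. f (x[i := q])) = 0" if "x \<in> words Q n" "i < n" for x i
    using f that by (simp add: signed_def zero_sum_def)
  have "card {q \<in> Q. x[i := q] \<in> ?U} \<in> {0, 2}" if xi: "x \<in> words Q n" "i < n" for x i
  proof -
    obtain p q r where pqr: "Q = {p, q, r}" "p \<noteq> q" "p \<noteq> r" "q \<noteq> r"
      using card_3_obtain[OF Q] .
    have *: "x[i := y] \<in> words Q n" if "y \<in> Q" for y
      using update_in_words xi that by metis
    let ?a = "f (x[i := p])" and ?b = "f (x[i := q])" and ?c = "f (x[i := r])"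
    have abc: "?a + ?b + ?c = 0" using sum0[OF xi] pqr by (simp add: add.assoc)
    have "?a \<in> {-1, 0, 1}" "?b \<in> {-1, 0, 1}" "?c \<in> {-1, 0, 1}"
      using val * pqr(1) by blast+
    then have "?a = 0 \<and> ?b = 0 \<and> ?c = 0 \<or> ?a \<noteq> 0 \<and> ?b \<noteq> 0 \<and> ?c = 0 \<or>
        ?a \<noteq> 0 \<and> ?b = 0 \<and> ?c \<noteq> 0 \<or> ?a = 0 \<and> ?b \<noteq> 0 \<and> ?c \<noteq> 0"
      using abc by auto
    moreover have "{y \<in> Q. x[i := y] \<in> ?U} = {y \<in> {p, q, r}. f (x[i := y]) \<noteq> 0}"
      using * pqr(1) by (auto simp: supp_def)
    moreover have "{y \<in> {p, q, r}. f (x[i := y]) \<noteq> 0} = (if ?a \<noteq> 0 then {p} else {}) \<union>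
        (if ?b \<noteq> 0 then {q} else {}) \<union> (if ?c \<noteq> 0 then {r} else {})"
      by auto
    ultimately show ?thesis using pqr(2-4) by (elim disjE) simp_all
  qed
  then have "unitrade Q n ?U" unfolding unitrade_iff using UW by blast
  moreover have opposite: "x \<in> {x \<in> ?U. f x = 1} \<longleftrightarrow> x[i := q] \<in> {x \<in> ?U. f x = -1}"
    if x: "x \<in> ?U" and i: "i < n" and q: "q \<in> Q" "x[i := q] \<in> ?U" "q \<noteq> x ! i" for x i q
  proof -
    have xW: "x \<in> words Q n" "f x \<noteq> 0" using x by (auto simp: supp_def)
    then have xi: "x ! i \<in> Q" using i by (auto simp: words_def)
    have "card (Q - {x ! i, q}) = 1"
      using Q xi q by (subst card_Diff_subset) auto
    then obtain r where r: "Q - {x ! i, q} = {r}" by (meson card_1_singletonE)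
    then have Qr: "Q = {x ! i, q, r}" "r \<noteq> x ! i" "r \<noteq> q" using xi q by auto
    have "(\<Sum>y\<in>{x ! i, q, r}. f (x[i := y])) = 0"
      using sum0[OF xW(1) i] unfolding Qr(1)[symmetric] .
    then have "f x + f (x[i := q]) + f (x[i := r]) = 0"
      using Qr(2,3) q(3) by (simp add: add.assoc)
    moreover have "x[i := r] \<in> words Q n" using update_in_words[OF xW(1)] r by blast
    moreover have xq: "x[i := q] \<in> words Q n" "f (x[i := q]) \<noteq> 0"
      using q(2) by (simp_all add: supp_def)
    ultimately have "f x = - f (x[i := q])"
      using sum_3_signs[OF val[OF xW(1)] val[OF xq(1)] val] xW(2) by blast
    then show ?thesis using x q(2) by simp
  qed
  then have "bipartite (hamming_graph Q n \<restriction> ?U)"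
    unfolding bipartite_induced_iff[OF UW]
  proof (intro exI conjI ballI allI impI)
    show "{x \<in> ?U. f x = 1} \<union> {x \<in> ?U. f x = -1} = ?U"
      using val by (auto simp: supp_def)
    show "{x \<in> ?U. f x = 1} \<inter> {x \<in> ?U. f x = -1} = {}" by auto
  qed (rule opposite)
  ultimately show ?thesis by (simp add: bitrade_def)
qed

lemma bitrade_iff_signed:
  assumes "card Q = 3"
  shows "bitrade Q n U \<longleftrightarrow> (\<exists>f. signed Q n f \<and> U = supp Q n f)"
  using assms bitrade_of_signed signed_of_bitrade by metis

section \<open>Constructions\<close>

text \<open>A zero-sum function on \<open>{p, q, r}\<^sup>n\<close> is determined by its values on \<open>{p, q}\<^sup>n\<close>; these are
  the leaves of a binary tree, the two subtrees of a node being the layers \<open>p\<close> and \<open>q\<close>.\<close>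

datatype tree = Leaf int | Node tree tree

text \<open>The last equation is a default for trees of different shapes, which \<open>full\<close>
  and \<open>sign_tree\<close> rule out.\<close>

fun tree_add :: "tree \<Rightarrow> tree \<Rightarrow> tree" where
  "tree_add (Leaf a) (Leaf b) = Leaf (a + b)"
| "tree_add (Node s t) (Node s' t') = Node (tree_add s s') (tree_add t t')"
| "tree_add _ _ = Leaf 0"

fun full :: "nat \<Rightarrow> tree \<Rightarrow> bool" where
  "full 0 (Leaf a) \<longleftrightarrow> True"
| "full (Suc n) (Node s t) \<longleftrightarrow> full n s \<and> full n t"
| "full _ _ \<longleftrightarrow> False"

text \<open>The layer r is minus the sum of the other two. Neither the set {-1, 0, 1} nor the number
  of nonzero values depends on that sign, so \<open>tree_add s t\<close> represents the layer here
  and in \<open>weight\<close>.\<close>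

fun sign_tree :: "nat \<Rightarrow> tree \<Rightarrow> bool" where
  "sign_tree 0 (Leaf a) \<longleftrightarrow> a \<in> {-1, 0, 1}"
| "sign_tree (Suc n) (Node s t) \<longleftrightarrow> sign_tree n s \<and> sign_tree n t \<and> sign_tree n (tree_add s t)"
| "sign_tree _ _ \<longleftrightarrow> False"

fun weight :: "nat \<Rightarrow> tree \<Rightarrow> nat" where
  "weight 0 (Leaf a) = (if a = 0 then 0 else 1)"
| "weight (Suc n) (Node s t) = weight n s + weight n t + weight n (tree_add s t)"
| "weight _ _ = 0"

fun eval_tree :: "'a \<Rightarrow> 'a \<Rightarrow> tree \<Rightarrow> 'a list \<Rightarrow> int" where
  "eval_tree p q (Leaf a) w = a"
| "eval_tree p q (Node s t) (x # w) =
     (if x = p then eval_tree p q s w else if x = q then eval_tree p q t w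
      else - eval_tree p q s w - eval_tree p q t w)"
| "eval_tree p q (Node s t) [] = 0"

primrec zero_tree :: "nat \<Rightarrow> tree" where
  "zero_tree 0 = Leaf 0"
| "zero_tree (Suc n) = Node (zero_tree n) (zero_tree n)"

lemma full_0: "full 0 t \<Longrightarrow> \<exists>a. t = Leaf a"
  by (cases t) auto

lemma full_Suc: "full (Suc n) t \<Longrightarrow> \<exists>u v. t = Node u v \<and> full n u \<and> full n v"
  by (cases t) auto

lemma full_of_sign_tree: "sign_tree n t \<Longrightarrow> full n t"
  by (induction n t rule: sign_tree.induct) auto

lemma eval_tree_add:
  "full n s \<Longrightarrow> full n t \<Longrightarrow> length w = n \<Longrightarrow>
    eval_tree p q (tree_add s t) w = eval_tree p q s w + eval_tree p q t w"
proof (induction n arbitrary: s t w)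
  case 0
  then show ?case by (auto dest!: full_0)
next
  case (Suc n)
  then show ?case by (cases w) (auto dest!: full_Suc)
qed

lemma tree_add_zero:
  "full n t \<Longrightarrow> tree_add t (zero_tree n) = t \<and> tree_add (zero_tree n) t = t"
proof (induction n arbitrary: t)
  case 0
  then show ?case by (auto dest!: full_0)
next
  case (Suc n)
  then show ?case by (auto dest!: full_Suc)
qed

lemma full_zero_tree: "full n (zero_tree n)"
  by (induction n) auto

lemma sign_zero_tree: "sign_tree n (zero_tree n)"
  by (induction n) (auto simp: tree_add_zero full_zero_tree)

lemma weight_zero_tree: "weight n (zero_tree n) = 0"
  by (induction n) (auto simp: tree_add_zero full_zero_tree)

lemma zero_sum_eval_tree:
  assumes "p \<noteq> q" "p \<noteq> r" "q \<noteq> r"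
  shows "full n t \<Longrightarrow> zero_sum {p, q, r} n (eval_tree p q t)"
proof (induction n arbitrary: t)
  case 0
  then show ?case by (simp add: zero_sum_def)
next
  case (Suc n)
  obtain u v where t: "t = Node u v" and uv: "full n u" "full n v"
    using full_Suc[OF Suc.prems] by blast
  show ?case
    unfolding zero_sum_def
  proof (intro ballI allI impI)
    fix w i assume w: "w \<in> words {p, q, r} (Suc n)" and i: "i < Suc n"
    obtain x w' where w': "w = x # w'" "w' \<in> words {p, q, r} n" "x = p \<or> x = q \<or> x = r"
      using words_SucE[OF w] by blast
    show "(\<Sum>y\<in>{p, q, r}. eval_tree p q t (w[i := y])) = 0"
    proof (cases i)
      case 0
      then show ?thesis using assms w' t by simp
    next
      case (Suc j)
      then have "(\<Sum>y\<in>{p, q, r}. eval_tree p q u (w'[j := y])) = 0"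
        "(\<Sum>y\<in>{p, q, r}. eval_tree p q v (w'[j := y])) = 0"
        using Suc.IH[OF uv(1)] Suc.IH[OF uv(2)] i w'(2) unfolding zero_sum_def by auto
      then show ?thesis using assms w' t Suc by simp
    qed
  qed
qed

lemma signed_eval_tree:
  assumes "p \<noteq> q" "p \<noteq> r" "q \<noteq> r"
  shows "sign_tree n t \<Longrightarrow>
    signed {p, q, r} n (eval_tree p q t) \<and> card (supp {p, q, r} n (eval_tree p q t)) = weight n t"
proof (induction n arbitrary: t)
  case 0
  then obtain a where "t = Leaf a" "a \<in> {-1, 0, 1}" by (cases t) auto
  then show ?case by (auto simp: signed_def zero_sum_def supp_def)
next
  case (Suc n)
  then obtain u v where t: "t = Node u v"
    and uv: "sign_tree n u" "sign_tree n v" "sign_tree n (tree_add u v)" by (cases t) auto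
  let ?W = "words {p, q, r} n" and ?e = "eval_tree p q"
  have layer_r: "?e t (r # w) = - ?e (tree_add u v) w" if "w \<in> ?W" for w
    using eval_tree_add[of n u v w p q] uv that assms
    by (simp add: t full_of_sign_tree words_def)
  have layers: "?e t (p # w) = ?e u w" "?e t (q # w) = ?e v w" for w
    using assms by (simp_all add: t)
  have "supp {p, q, r} n (\<lambda>w. ?e t (r # w)) = supp {p, q, r} n (?e (tree_add u v))"
    using layer_r by (auto simp: supp_def)
  then have "card (supp {p, q, r} (Suc n) (?e t)) = weight (Suc n) t"
    using Suc.IH[OF uv(1)] Suc.IH[OF uv(2)] Suc.IH[OF uv(3)] assms
    by (subst card_supp_Suc) (simp_all add: layers, simp add: t)
  moreover have "?e t w \<in> {-1, 0, 1}" if w: "w \<in> words {p, q, r} (Suc n)" for w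
  proof -
    obtain x w' where w': "w = x # w'" and x: "x = p \<or> x = q \<or> x = r" and w'W: "w' \<in> ?W"
      using words_SucE[OF w] by blast
    have "?e u w' \<in> {-1, 0, 1}" "?e v w' \<in> {-1, 0, 1}" "- ?e (tree_add u v) w' \<in> {-1, 0, 1}"
      using Suc.IH[OF uv(1)] Suc.IH[OF uv(2)] Suc.IH[OF uv(3)] w'W by (auto simp: signed_def)
    then show ?thesis
      using x layers layer_r[OF w'W] by (metis w')
  qed
  moreover have "zero_sum {p, q, r} (Suc n) (?e t)"
    using zero_sum_eval_tree[OF assms full_of_sign_tree[OF Suc.prems]] .
  ultimately show ?case by (auto simp: signed_def)
qed

lemma signed_of_tree:
  assumes Q: "card Q = 3" and "sign_tree n t"
  shows "\<exists>f. signed Q n f \<and> card (supp Q n f) = weight n t"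
proof -
  obtain p q r where "Q = {p, q, r}" "p \<noteq> q" "p \<noteq> r" "q \<noteq> r"
    using card_3_obtain[OF Q] .
  then show ?thesis using signed_eval_tree[OF _ _ _ assms(2)] by metis
qed

section \<open>Sizes realised by trees\<close>

definition tree_size :: "nat \<Rightarrow> nat \<Rightarrow> bool" where
  "tree_size n s \<longleftrightarrow> (\<exists>t. sign_tree n t \<and> weight n t = s)"

text \<open>A new coordinate with layers t, 0 and -t doubles the weight.\<close>

lemma tree_size_double: "tree_size n s \<Longrightarrow> tree_size (n + m) (2 ^ m * s)"
proof (induction m)
  case (Suc m)
  then obtain t where t: "sign_tree (n + m) t" "weight (n + m) t = 2 ^ m * s"
    by (auto simp: tree_size_def)
  then have "sign_tree (n + Suc m) (Node t (zero_tree (n + m)))"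
    "weight (n + Suc m) (Node t (zero_tree (n + m))) = 2 ^ Suc m * s"
    by (simp_all add: tree_add_zero full_of_sign_tree sign_zero_tree weight_zero_tree)
  then show ?case unfolding tree_size_def by blast
qed simp

text \<open>The family of sizes \<open>5/2 2\<^sup>n - 6\<close> comes from the tensor \<open>\<alpha>\<^sup>n - \<beta>\<^sup>n\<^sup>-\<^sup>2\<alpha>\<^sup>2 + \<beta>\<^sup>n\<close>, where \<open>\<alpha>\<close> and \<open>\<beta>\<close>
  are the zero-sum functions supported on \<open>{p, r}\<close> and \<open>{q, r}\<close> with value 1 at \<open>r\<close>. Up to a common
  sign, \<open>A\<close> is \<open>\<alpha>\<^sup>n\<close> and \<open>D\<close> is \<open>\<beta>\<^sup>n\<^sup>-\<^sup>2(\<beta>\<^sup>2 - \<alpha>\<^sup>2)\<close>.\<close>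

lemma tree_size_family_aux:
  "\<exists>A D. sign_tree (n + 2) A \<and> sign_tree (n + 2) D \<and> sign_tree (n + 2) (tree_add A D) \<and>
    weight (n + 2) A = 4 * 2 ^ n \<and> weight (n + 2) D = 6 * 2 ^ n \<and>
    weight (n + 2) (tree_add A D) + 6 = 10 * 2 ^ n"
proof (induction n)
  case 0
  let ?A = "Node (Node (Leaf 1) (Leaf 0)) (Node (Leaf 0) (Leaf 0))"
  let ?D = "Node (Node (Leaf (-1)) (Leaf 0)) (Node (Leaf 0) (Leaf 1))"
  show ?case
    by (intro exI[of _ ?A] exI[of _ ?D]) (simp add: numeral_2_eq_2)
next
  case (Suc n)
  then obtain A D where AD: "sign_tree (n + 2) A" "sign_tree (n + 2) D" "sign_tree (n + 2) (tree_add A D)"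
    "weight (n + 2) A = 4 * 2 ^ n" "weight (n + 2) D = 6 * 2 ^ n"
    "weight (n + 2) (tree_add A D) + 6 = 10 * 2 ^ n"
    by blast
  define k where "k = n + 2"
  let ?Z = "zero_tree k"
  \<comment> \<open>One more factor is multiplied in front of A and of D. Their sum then has the
    layers A and D and, up to sign, A + D, of total weight (4 + 6 + 10) * 2^n - 6.\<close>
  have "sign_tree (Suc k) (Node A ?Z) \<and> sign_tree (Suc k) (Node ?Z D) \<and>
      sign_tree (Suc k) (tree_add (Node A ?Z) (Node ?Z D)) \<and>
      weight (Suc k) (Node A ?Z) = 4 * 2 ^ Suc n \<and> weight (Suc k) (Node ?Z D) = 6 * 2 ^ Suc n \<and>
      weight (Suc k) (tree_add (Node A ?Z) (Node ?Z D)) + 6 = 10 * 2 ^ Suc n"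
    using AD unfolding k_def[symmetric]
    by (simp add: tree_add_zero full_of_sign_tree sign_zero_tree weight_zero_tree)
  moreover have "Suc n + 2 = Suc k" by (simp add: k_def)
  ultimately show ?case by metis
qed

lemma tree_size_family:
  assumes "n \<ge> 3"
  shows "tree_size n (5 * 2 ^ (n - 1) - 6)"
proof -
  define k where "k = n - 2"
  have n: "n = k + 2" using assms by (simp add: k_def)
  obtain A D where "sign_tree n (tree_add A D)" "weight n (tree_add A D) + 6 = 10 * 2 ^ k"
    using tree_size_family_aux[of k] unfolding n by blast
  then show ?thesis unfolding tree_size_def n by (intro exI[of _ "tree_add A D"]) auto
qed

text \<open>With p, q, r read as 0, 1, 2, the value depends only on the sum of the coordinates
  modulo 3 and is 1, -1, 0 for the sums 0, 1, 2. No line vanishes, which gives 2 * 9 words.\<close>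

lemma tree_size_18: "tree_size 3 18"
  unfolding tree_size_def
  by (intro exI[of _ "Node
    (Node (Node (Leaf 1) (Leaf (-1))) (Node (Leaf (-1)) (Leaf 0)))
    (Node (Node (Leaf (-1)) (Leaf 0)) (Node (Leaf 0) (Leaf 1)))"]) code_simp

text \<open>The layers in the first direction have sizes 12, 14 and 14, that is 3/2, 7/4 and 7/4
  times 2^3.\<close>

lemma tree_size_40: "tree_size 4 40"
  unfolding tree_size_def
  by (intro exI[of _ "Node
    (Node (Node (Node (Leaf (-1)) (Leaf 0)) (Node (Leaf 0) (Leaf 0)))
      (Node (Node (Leaf 0) (Leaf 0)) (Node (Leaf 1) (Leaf 0))))
    (Node (Node (Node (Leaf 0) (Leaf 0)) (Node (Leaf 0) (Leaf 1)))
      (Node (Node (Leaf 1) (Leaf (-1))) (Node (Leaf (-1)) (Leaf 0))))"]) code_simp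

text \<open>The tree of \<open>\<alpha>\<^sup>4\<alpha> - \<beta>\<^sup>2\<alpha>\<^sup>2\<beta> + \<beta>\<^sup>4(\<beta> - \<alpha>)\<close>.\<close>

lemma tree_size_78: "tree_size 5 78"
proof -
  let ?Z1 = "Node (Leaf 0) (Leaf 0)"
  let ?Z2 = "Node ?Z1 ?Z1"
  show ?thesis
    unfolding tree_size_def
    by (intro exI[of _ "Node
      (Node (Node (Node (Node (Leaf (-1)) (Leaf 0)) ?Z1) ?Z2) (Node ?Z2 ?Z2))
      (Node (Node ?Z2 ?Z2) (Node (Node (Node (Leaf 0) (Leaf 1)) ?Z1)
        (Node ?Z1 (Node (Leaf 1) (Leaf (-1))))))"]) code_simp
qed

section \<open>Boxes and supports of size less than \<open>2\<^sup>n\<^sup>+\<^sup>1\<close>\<close>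

definition box :: "'a set list \<Rightarrow> 'a list set" where
  "box As = {w. list_all2 (\<in>) w As}"

text \<open>The pairs are the supports of the nonzero signed functions of one coordinate, so boxes
  with such sides are the supports of their tensor products.\<close>

definition pairs :: "'a set \<Rightarrow> 'a set set" where
  "pairs Q = {A. A \<subseteq> Q \<and> card A = 2}"

lemma box_Nil [simp]: "box [] = {[]}"
  by (auto simp: box_def)

lemma Cons_in_box [simp]: "x # w \<in> box (A # As) \<longleftrightarrow> x \<in> A \<and> w \<in> box As"
  by (simp add: box_def)

lemma Cons_in_box_iff: "x # w \<in> box As \<longleftrightarrow> (\<exists>B Bs. As = B # Bs \<and> x \<in> B \<and> w \<in> box Bs)"
  by (cases As) (auto simp: box_def)

lemma append_in_box:
  "length u = length As \<Longrightarrow> u @ v \<in> box (As @ Bs) \<longleftrightarrow> u \<in> box As \<and> v \<in> box Bs"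
  by (auto simp: box_def list_all2_append)

lemma length_box: "w \<in> box As \<Longrightarrow> length w = length As"
  by (auto simp: box_def list_all2_lengthD)

lemma nth_box: "w \<in> box As \<Longrightarrow> i < length As \<Longrightarrow> w ! i \<in> As ! i"
  by (auto simp: box_def list_all2_conv_all_nth)

lemma box_Cons: "box (A # As) = (\<lambda>(x, w). x # w) ` (A \<times> box As)"
  by (auto simp: box_def list_all2_Cons2)

lemma card_box: "card (box As) = prod_list (map card As)"
proof (induction As)
  case (Cons A As)
  have "inj_on (\<lambda>(x, w). x # w) (A \<times> box As)" by (auto simp: inj_on_def)
  then show ?case by (simp add: box_Cons card_image card_cartesian_product Cons)
qed simp

lemma finite_box: "(\<And>A. A \<in> set As \<Longrightarrow> finite A) \<Longrightarrow> finite (box As)"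
  by (induction As) (auto simp: box_Cons)

lemma box_map_Int: "box (map f Ts) \<inter> box (map g Ts) = box (map (\<lambda>t. f t \<inter> g t) Ts)"
  by (auto simp: box_def list_all2_conv_all_nth)

lemma box_mono:
  assumes "length As = length Bs" "\<And>i. i < length As \<Longrightarrow> As ! i \<subseteq> Bs ! i"
  shows "box As \<subseteq> box Bs"
  using assms by (auto simp: box_def list_all2_conv_all_nth) blast

lemma card_sym_diff:
  assumes "finite A" "finite B"
  shows "int (card (sym_diff A B)) = int (card A) + int (card B) - 2 * int (card (A \<inter> B))"
proof -
  have "card (sym_diff A B) = card (A - B) + card (B - A)"
    by (rule card_Un_disjoint) (use assms in auto)
  moreover have "card A = card (A - B) + card (A \<inter> B)" "card B = card (B - A) + card (A \<inter> B)"
    using assms card_Int_Diff[of A B] card_Int_Diff[of B A] by (simp_all add: Int_commute)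
  ultimately show ?thesis by simp
qed

context
  fixes Q :: "'a set"
  assumes card_Q: "card Q = 3"
begin

lemma finite_Q: "finite Q"
  using card_Q by (metis card.infinite zero_neq_numeral)

lemma pairsD: "A \<in> pairs Q \<Longrightarrow> finite A \<and> A \<subseteq> Q \<and> card A = 2"
  using finite_Q finite_subset by (auto simp: pairs_def)

lemma pairs_eq_Diff:
  assumes "A \<in> pairs Q"
  obtains a where "a \<in> Q" "A = Q - {a}"
proof -
  have "card (Q - A) = 1"
    using pairsD[OF assms] card_Q by (simp add: card_Diff_subset)
  then obtain a where "Q - A = {a}" by (meson card_1_singletonE)
  then have "a \<in> Q" "A = Q - {a}" using pairsD[OF assms] by blast+
  then show thesis by (rule that)
qed

lemma card_pairs_Int:
  assumes "A \<in> pairs Q" "B \<in> pairs Q"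
  shows "card (A \<inter> B) = (if A = B then 2 else 1)"
proof -
  obtain a b where ab: "a \<in> Q" "A = Q - {a}" "b \<in> Q" "B = Q - {b}"
    using assms pairs_eq_Diff by metis
  then have "A \<inter> B = Q - {a, b}" by blast
  then have "card (A \<inter> B) = 3 - card {a, b}"
    using ab card_Q by (simp add: card_Diff_subset)
  moreover have "A = B \<longleftrightarrow> a = b" using ab by blast
  ultimately show ?thesis by auto
qed

text \<open>The three pairs are the complements of the three points of \<open>Q\<close>.\<close>

lemma pairs_triple_Int:
  assumes "A \<in> pairs Q" "B \<in> pairs Q" "C \<in> pairs Q" "A \<noteq> B" "A \<noteq> C" "B \<noteq> C"
  shows "A \<inter> B \<inter> C = {}"
proof -
  obtain a b c where abc: "a \<in> Q" "A = Q - {a}" "b \<in> Q" "B = Q - {b}" "c \<in> Q" "C = Q - {c}"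
    using assms(1-3) pairs_eq_Diff by metis
  then have "card {a, b, c} = 3" using assms(4-6) by auto
  then have "{a, b, c} = Q" using abc card_Q finite_Q by (intro card_subset_eq) auto
  then show ?thesis using abc by blast
qed

lemma card_box_pairs: "set As \<subseteq> pairs Q \<Longrightarrow> card (box As) = 2 ^ length As"
  by (induction As) (auto simp: card_box dest: pairsD)

lemma finite_box_pairs: "set As \<subseteq> pairs Q \<Longrightarrow> finite (box As)"
  by (rule finite_box) (use pairsD in blast)

text \<open>Equal pairs contribute a factor 2, different ones share a single value. Both boxes are
  projections of one list, so the lemma serves lists of pairs as well as lists of triples.\<close>

lemma card_box_Int:
  "(\<forall>t\<in>set Ts. f t \<in> pairs Q \<and> g t \<in> pairs Q) \<Longrightarrow>
    card (box (map f Ts) \<inter> box (map g Ts)) = 2 ^ length (filter (\<lambda>t. f t = g t) Ts)"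
  unfolding box_map_Int card_box by (induction Ts) (auto simp: card_pairs_Int)

lemma card_sym_diff_boxes:
  assumes "set Ps \<subseteq> pairs Q \<times> pairs Q"
  shows "int (card (sym_diff (box (map fst Ps)) (box (map snd Ps)))) =
    2 * 2 ^ length Ps - 2 * 2 ^ length (filter (\<lambda>(A, B). A = B) Ps)"
proof -
  have "set (map fst Ps) \<subseteq> pairs Q" "set (map snd Ps) \<subseteq> pairs Q"
    using assms by auto
  then show ?thesis
    using assms card_box_Int[of Ps fst snd]
    by (subst card_sym_diff) (auto simp: finite_box_pairs card_box_pairs case_prod_unfold)
qed

section \<open>Layers and the classification of small supports\<close>

lemma layer_r:
  assumes f: "signed Q (Suc n) f" and Q: "Q = {p, q, r}" "p \<noteq> q" "p \<noteq> r" "q \<noteq> r"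
  shows "supp Q n (\<lambda>w. f (r # w)) =
    sym_diff (supp Q n (\<lambda>w. f (p # w))) (supp Q n (\<lambda>w. f (q # w)))"
proof -
  \<comment> \<open>Parity: if three values in {-1, 0, 1} have sum 0, an even number of them is
    nonzero.\<close>
  have "f (r # w) \<noteq> 0 \<longleftrightarrow> (f (p # w) \<noteq> 0) \<noteq> (f (q # w) \<noteq> 0)" if w: "w \<in> words Q n" for w
  proof -
    have "f (p # w) + f (q # w) + f (r # w) = 0"
      using f w zero_sum_head[of Q n f w] Q by (simp add: signed_def add.assoc)
    moreover have "f (p # w) \<in> {-1, 0, 1}" "f (q # w) \<in> {-1, 0, 1}" "f (r # w) \<in> {-1, 0, 1}"
      using f w Q(1) by (auto simp: signed_def)
    ultimately show ?thesis by auto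
  qed
  then show ?thesis by (auto simp: supp_def)
qed

text \<open>With r naming the largest layer, \<open>layer_r\<close> expresses it through the two
  smaller ones.\<close>

lemma sorted_layers:
  assumes f: "signed Q (Suc n) f"
  obtains p q r where "Q = {p, q, r}" "p \<noteq> q" "p \<noteq> r" "q \<noteq> r"
    "card (supp Q n (\<lambda>w. f (p # w))) \<le> card (supp Q n (\<lambda>w. f (q # w)))"
    "card (supp Q n (\<lambda>w. f (q # w))) \<le> card (supp Q n (\<lambda>w. f (r # w)))"
    "card (supp Q (Suc n) f) = card (supp Q n (\<lambda>w. f (p # w))) + card (supp Q n (\<lambda>w. f (q # w)))
      + card (supp Q n (\<lambda>w. f (r # w)))"
proof -
  define S where "S x = card (supp Q n (\<lambda>w. f (x # w)))" for x
  obtain a b c where abc: "Q = {a, b, c}" "a \<noteq> b" "a \<noteq> c" "b \<noteq> c"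
    using card_3_obtain[OF card_Q] .
  have "\<exists>p q r. {a, b, c} = {p, q, r} \<and> p \<noteq> q \<and> p \<noteq> r \<and> q \<noteq> r \<and> S p \<le> S q \<and> S q \<le> S r"
  proof -
    have "S a \<le> S b \<and> S b \<le> S c \<or> S a \<le> S c \<and> S c \<le> S b \<or> S b \<le> S a \<and> S a \<le> S c \<or>
      S b \<le> S c \<and> S c \<le> S a \<or> S c \<le> S a \<and> S a \<le> S b \<or> S c \<le> S b \<and> S b \<le> S a"
      by linarith
    then show ?thesis using abc(2-4) by (metis insert_commute)
  qed
  then obtain p q r where pqr: "Q = {p, q, r}" "p \<noteq> q" "p \<noteq> r" "q \<noteq> r" "S p \<le> S q" "S q \<le> S r"
    using abc(1) by metis
  moreover have "card (supp Q (Suc n) f) = S p + S q + S r"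
  proof -
    have "card (supp Q (Suc n) f) = (\<Sum>x\<in>Q. S x)"
      unfolding S_def by (rule card_supp_Suc[OF finite_Q])
    then show ?thesis using pqr by simp
  qed
  ultimately show thesis using that unfolding S_def by blast
qed

text \<open>By \<open>layer_r\<close> two layers determine the support; the premise
  \<open>other\<close> keeps words with a foreign first letter out of U.\<close>

lemma supp_Suc_eqI:
  assumes f: "signed Q (Suc n) f" and Q: "Q = {p, q, r}" "p \<noteq> q" "p \<noteq> r" "q \<noteq> r"
    and U: "\<And>w. w \<in> U \<Longrightarrow> length w = Suc n"
    and p: "\<And>w. p # w \<in> U \<longleftrightarrow> w \<in> supp Q n (\<lambda>w. f (p # w))"
    and q: "\<And>w. q # w \<in> U \<longleftrightarrow> w \<in> supp Q n (\<lambda>w. f (q # w))"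
    and r: "\<And>w. r # w \<in> U \<longleftrightarrow>
      w \<in> sym_diff (supp Q n (\<lambda>w. f (p # w))) (supp Q n (\<lambda>w. f (q # w)))"
    and other: "\<And>x w. x # w \<in> U \<Longrightarrow> x \<in> Q"
  shows "supp Q (Suc n) f = U"
proof (rule set_eqI)
  fix v
  show "v \<in> supp Q (Suc n) f \<longleftrightarrow> v \<in> U"
  proof (cases v)
    case Nil
    then show ?thesis using U[of "[]"] by (auto simp: supp_def words_def)
  next
    case (Cons x w)
    have "x \<in> Q \<Longrightarrow> x = p \<or> x = q \<or> x = r" using Q(1) by simp
    moreover have "p \<in> Q" "q \<in> Q" "r \<in> Q" using Q(1) by simp_all
    ultimately show ?thesis
      unfolding Cons Cons_in_supp using p q r layer_r[OF f Q] other by metis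
  qed
qed

lemma pairs_of_distinct:
  "Q = {p, q, r} \<Longrightarrow> p \<noteq> q \<Longrightarrow> p \<noteq> r \<Longrightarrow> q \<noteq> r \<Longrightarrow> {p, r} \<in> pairs Q \<and> {q, r} \<in> pairs Q"
  by (simp add: pairs_def)

lemma length_filter_zip_less:
  assumes "As \<noteq> Bs" "length As = n" "length Bs = n"
  shows "length (filter (\<lambda>(A, B). A = B) (zip As Bs)) < n"
proof -
  obtain i where i: "i < n" "As ! i \<noteq> Bs ! i"
    using assms by (metis nth_equalityI)
  then have "(As ! i, Bs ! i) \<in> set (zip As Bs)"
    using assms by (auto simp: in_set_zip)
  then show ?thesis
    using length_filter_less[of "(As ! i, Bs ! i)" "zip As Bs" "\<lambda>(A, B). A = B"] i(2) assms by auto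
qed

text \<open>The three forms have \<open>0\<close>, \<open>2\<^sup>n\<close> and \<open>2\<^sup>n\<^sup>+\<^sup>1 - 2\<^sup>k\<^sup>+\<^sup>1\<close> elements, where \<open>k \<le> n - 2\<close> is the
  number of coordinates in which the two boxes agree.\<close>

lemma small_supp_cases:
  assumes "signed Q n f" "card (supp Q n f) < 2 * 2 ^ n"
  obtains (empty) "supp Q n f = {}"
  | (box) As where "set As \<subseteq> pairs Q" "length As = n" "supp Q n f = box As"
  | (two) Ps where "set Ps \<subseteq> pairs Q \<times> pairs Q" "length Ps = n"
      "length (filter (\<lambda>(A, B). A = B) Ps) + 2 \<le> n"
      "supp Q n f = sym_diff (box (map fst Ps)) (box (map snd Ps))"
proof -
  have "supp Q n f = {} \<or> (\<exists>As. set As \<subseteq> pairs Q \<and> length As = n \<and> supp Q n f = box As) \<or>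
    (\<exists>Ps. set Ps \<subseteq> pairs Q \<times> pairs Q \<and> length Ps = n \<and>
      length (filter (\<lambda>(A, B). A = B) Ps) + 2 \<le> n \<and>
      supp Q n f = sym_diff (box (map fst Ps)) (box (map snd Ps)))"
    using assms
  proof (induction n arbitrary: f)
    case 0
    have "supp Q 0 f = {} \<or> supp Q 0 f = box []" by (auto simp: supp_def)
    then show ?case by auto
  next
    case (Suc n)
    obtain p q r where Q: "Q = {p, q, r}" "p \<noteq> q" "p \<noteq> r" "q \<noteq> r"
      and le: "card (supp Q n (\<lambda>w. f (p # w))) \<le> card (supp Q n (\<lambda>w. f (q # w)))"
        "card (supp Q n (\<lambda>w. f (q # w))) \<le> card (supp Q n (\<lambda>w. f (r # w)))"
      and sum: "card (supp Q (Suc n) f) = card (supp Q n (\<lambda>w. f (p # w))) +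
        card (supp Q n (\<lambda>w. f (q # w))) + card (supp Q n (\<lambda>w. f (r # w)))"
      using sorted_layers[OF Suc.prems(1)] by metis
    let ?Sp = "supp Q n (\<lambda>w. f (p # w))" and ?Sq = "supp Q n (\<lambda>w. f (q # w))"
      and ?Sr = "supp Q n (\<lambda>w. f (r # w))"
    have sg: "signed Q n (\<lambda>w. f (p # w))" "signed Q n (\<lambda>w. f (q # w))"
      by (rule signed_layer[OF Suc.prems(1)]; use Q(1) in blast)+
    have small: "card ?Sp < 2 * 2 ^ n" "card ?Sq < 2 * 2 ^ n"
      using sum le Suc.prems(2) by simp_all
    have eqI: "supp Q (Suc n) f = U"
      if "\<And>w. w \<in> U \<Longrightarrow> length w = Suc n" "\<And>w. p # w \<in> U \<longleftrightarrow> w \<in> ?Sp" "\<And>w. q # w \<in> U \<longleftrightarrow> w \<in> ?Sq"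
        "\<And>w. r # w \<in> U \<longleftrightarrow> w \<in> sym_diff ?Sp ?Sq" "\<And>x w. x # w \<in> U \<Longrightarrow> x \<in> Q" for U
      using supp_Suc_eqI[OF Suc.prems(1) Q that] .
    have pr: "{p, r} \<in> pairs Q" and qr: "{q, r} \<in> pairs Q" using pairs_of_distinct[OF Q] by auto
    have QI: "q \<in> Q" "r \<in> Q" "p \<in> Q" using Q(1) by simp_all
    show ?case
    proof (cases "?Sp = {}")
      \<comment> \<open>The layers q and r now have the same support, so the description of the
        layer q only gains a side {q, r} in front.\<close>
      case True
      from Suc.IH[OF sg(2) small(2)] show ?thesis
      proof (elim disjE exE conjE)
        assume "?Sq = {}"
        then have "supp Q (Suc n) f = {}" using True by (intro eqI) auto
        then show ?thesis by blast
      next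
        fix As assume As: "set As \<subseteq> pairs Q" "length As = n" "?Sq = box As"
        have "supp Q (Suc n) f = box ({q, r} # As)"
          using True As Q(2-4) QI by (intro eqI) (auto dest: length_box simp: Cons_in_box_iff)
        then show ?thesis using As qr by (intro disjI2 disjI1 exI[of _ "{q, r} # As"]) auto
      next
        fix Ps assume Ps: "set Ps \<subseteq> pairs Q \<times> pairs Q" "length Ps = n"
          "length (filter (\<lambda>(A, B). A = B) Ps) + 2 \<le> n"
          "?Sq = sym_diff (box (map fst Ps)) (box (map snd Ps))"
        let ?Ps = "({q, r}, {q, r}) # Ps"
        have "supp Q (Suc n) f = sym_diff (box (map fst ?Ps)) (box (map snd ?Ps))"
          using True Ps Q(2-4) QI by (intro eqI) (auto dest: length_box)
        then show ?thesis using Ps qr by (intro disjI2 exI[of _ ?Ps]) auto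
      qed
    next
      case False
      \<comment> \<open>Two boxes that differ in at least two coordinates leave at least (2 - 1/2) *
        2^n words, so anything smaller is a single box.\<close>
      have box_of: "\<exists>As. set As \<subseteq> pairs Q \<and> length As = n \<and> supp Q n g = box As"
        if g: "signed Q n g" "supp Q n g \<noteq> {}" "2 * card (supp Q n g) < 3 * 2 ^ n" for g
      proof -
        have False if Ps: "set Ps \<subseteq> pairs Q \<times> pairs Q" "length Ps = n"
          "length (filter (\<lambda>(A, B). A = B) Ps) + 2 \<le> n"
          "supp Q n g = sym_diff (box (map fst Ps)) (box (map snd Ps))" for Ps
        proof -
          let ?k = "length (filter (\<lambda>(A, B). A = B) Ps)"
          have "int (card (supp Q n g)) = 2 * 2 ^ n - 2 * 2 ^ ?k"
            using card_sym_diff_boxes[OF Ps(1)] Ps(2,4) by simp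
          moreover have "(2::int) ^ (?k + 2) \<le> 2 ^ n" using Ps(3) by (intro power_increasing) auto
          moreover have "int (2 * card (supp Q n g)) < int (3 * 2 ^ n)" using g(3) by (simp only: of_nat_less_iff)
          ultimately show False by (simp add: power_add)
        qed
        moreover have "card (supp Q n g) < 2 * 2 ^ n" using g(3) by simp
        ultimately show ?thesis using Suc.IH[OF g(1)] g(2) by blast
      qed
      \<comment> \<open>The layer p has at most a third of the total, hence is a box; the layer q
        then has at most half of the rest, which is below 3 * 2^n.\<close>
      have "3 * card ?Sp < 4 * 2 ^ n" using sum le Suc.prems(2) by simp
      then obtain As where As: "set As \<subseteq> pairs Q" "length As = n" "?Sp = box As"
        using box_of[OF sg(1) False] by auto
      then have "card ?Sp = 2 ^ n" using card_box_pairs by metis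
      then have "2 * card ?Sq < 3 * 2 ^ n" "?Sq \<noteq> {}" using sum le Suc.prems(2) by auto
      then obtain Bs where Bs: "set Bs \<subseteq> pairs Q" "length Bs = n" "?Sq = box Bs"
        using box_of[OF sg(2)] by blast
      \<comment> \<open>Equal boxes would cancel in the layer r. So they differ somewhere, and the
        new sides {p, r} and {q, r} supply the second difference.\<close>
      have "?Sr \<noteq> {}" using le \<open>card ?Sp = 2 ^ n\<close> by auto
      then have "As \<noteq> Bs" using layer_r[OF Suc.prems(1) Q] As(3) Bs(3) by auto
      then have "length (filter (\<lambda>(A, B). A = B) (zip As Bs)) < n"
        by (intro length_filter_zip_less) (use As(2) Bs(2) in auto)
      let ?Ps = "({p, r}, {q, r}) # zip As Bs"
      have "supp Q (Suc n) f = sym_diff (box (map fst ?Ps)) (box (map snd ?Ps))"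
        using As Bs Q(2-4) QI by (intro eqI) (auto dest: length_box)
      moreover have "set ?Ps \<subseteq> pairs Q \<times> pairs Q"
        using As(1) Bs(1) pr qr by (auto dest: set_zip_leftD set_zip_rightD)
      moreover have "{p, r} \<noteq> {q, r}" using Q(2-4) by auto
      ultimately show ?thesis
        using \<open>length (filter (\<lambda>(A, B). A = B) (zip As Bs)) < n\<close> As(2) Bs(2)
        by (intro disjI2 exI[of _ ?Ps]) auto
    qed
  qed
  then show thesis using that by metis
qed

end

section \<open>Faces\<close>

text \<open>Layers in an arbitrary direction; \<open>f (x # w)\<close> only gives those in the first
  one.\<close>

definition face :: "nat \<Rightarrow> 'a \<Rightarrow> ('a list \<Rightarrow> int) \<Rightarrow> 'a list \<Rightarrow> int" where
  "face l c f w = f (take l w @ c # drop l w)"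

lemma insert_in_words:
  assumes "w \<in> words Q n" "c \<in> Q"
  shows "take l w @ c # drop l w \<in> words Q (Suc n)"
proof -
  have "set (take l w) \<subseteq> Q" "set (drop l w) \<subseteq> Q"
    using assms(1) set_take_subset[of l w] set_drop_subset[of l w] unfolding words_def by blast+
  then show ?thesis using assms by (simp add: words_def)
qed

lemma zero_sum_face:
  assumes f: "zero_sum Q (Suc n) f" and l: "l \<le> n" and c: "c \<in> Q"
  shows "zero_sum Q n (face l c f)"
  unfolding zero_sum_def face_def
proof (intro ballI allI impI)
  fix w i assume w: "w \<in> words Q n" and i: "i < n"
  \<comment> \<open>Inserting c shifts the coordinates from l on by one.\<close>
  let ?v = "take l w @ c # drop l w" and ?j = "if i < l then i else Suc i"
  have "take l (w[i := q]) @ c # drop l (w[i := q]) = ?v[?j := q]" for q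
    using w i l by (auto simp: words_def list_update_append take_update_swap drop_update_swap
        list_update_beyond Suc_diff_le not_less split: nat.split)
  moreover have "(\<Sum>q\<in>Q. f (?v[?j := q])) = 0"
    using f insert_in_words[OF w c, of l] i unfolding zero_sum_def by simp
  ultimately show "(\<Sum>q\<in>Q. f (take l (w[i := q]) @ c # drop l (w[i := q]))) = 0"
    by simp
qed

lemma signed_face:
  assumes "signed Q (Suc n) f" "l \<le> n" "c \<in> Q"
  shows "signed Q n (face l c f)"
  using assms zero_sum_face[of Q n f l c] insert_in_words[of _ Q n c l]
  by (auto simp: signed_def face_def)

lemma supp_face_iff:
  assumes "c \<in> Q"
  shows "w \<in> supp Q n (face l c f) \<longleftrightarrow> w \<in> words Q n \<and> take l w @ c # drop l w \<in> supp Q (Suc n) f"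
  using insert_in_words[of w Q n c l] assms by (auto simp: supp_def face_def)

text \<open>When the layer q in direction l vanishes, the other two are negatives of each other,
  hence two copies of one support.\<close>

lemma supp_avoiding_value:
  assumes Q: "card Q = 3" and f: "signed Q (Suc n) f" and l: "l \<le> n" and q: "q \<in> Q"
    and avoid: "\<And>w. w \<in> supp Q (Suc n) f \<Longrightarrow> w ! l \<noteq> q"
  obtains g where "signed Q n g" "card (supp Q (Suc n) f) = 2 * card (supp Q n g)"
proof -
  have "card (Q - {q}) = 2" using Q q by simp
  then obtain a b where ab: "Q - {q} = {a, b}" "a \<noteq> b" by (meson card_2_iff)
  then have Qab: "Q = {q, a, b}" "q \<noteq> a" "q \<noteq> b" "a \<in> Q" "b \<in> Q" using q by blast+
  let ?ins = "\<lambda>c w. take l w @ c # drop l w"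
  let ?S = "supp Q n (face l a f)"
  have finQ: "finite Q" using Q by (metis card.infinite zero_neq_numeral)
  have len: "length w = n" if "w \<in> words Q n" for w using that by (simp add: words_def)
  have ins_eq: "?ins c w = ?ins d v \<longleftrightarrow> c = d \<and> w = v" if "w \<in> words Q n" "v \<in> words Q n" for c d w v
  proof -
    have "length (take l w) = length (take l v)" using that len by simp
    then have "?ins c w = ?ins d v \<longleftrightarrow> take l w = take l v \<and> c = d \<and> drop l w = drop l v" by simp
    then show ?thesis by (metis append_take_drop_id)
  qed
  have same: "?ins b w \<in> supp Q (Suc n) f \<longleftrightarrow> ?ins a w \<in> supp Q (Suc n) f" if w: "w \<in> words Q n" for w
  proof -
    have W: "?ins c w \<in> words Q (Suc n)" if "c \<in> Q" for c
      using insert_in_words[OF w that] .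
    have upd: "(?ins q w)[l := c] = ?ins c w" for c
      using len[OF w] l by (simp add: list_update_append)
    have "(\<Sum>c\<in>Q. f ((?ins q w)[l := c])) = 0"
      using f W[OF q] l unfolding signed_def zero_sum_def by simp
    then have "(\<Sum>c\<in>{q, a, b}. f (?ins c w)) = 0"
      unfolding upd using Qab(1) by simp
    then have "f (?ins q w) + f (?ins a w) + f (?ins b w) = 0"
      using Qab(2,3) ab(2) by (simp add: add.assoc)
    moreover have "?ins q w ! l = q" using len[OF w] l by (simp add: nth_append)
    then have "f (?ins q w) = 0" using avoid[of "?ins q w"] W[OF q] by (auto simp: supp_def)
    ultimately show ?thesis using W[OF Qab(4)] W[OF Qab(5)] by (auto simp: supp_def)
  qed
  have "supp Q (Suc n) f = ?ins a ` ?S \<union> ?ins b ` ?S"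
  proof (intro equalityI subsetI)
    fix v assume v: "v \<in> supp Q (Suc n) f"
    then have vW: "v \<in> words Q (Suc n)" by (simp add: supp_def)
    let ?w = "take l v @ drop (Suc l) v"
    have "set ?w \<subseteq> set v" using set_take_subset[of l v] set_drop_subset[of "Suc l" v] by simp
    then have w: "?w \<in> words Q n" using vW l by (auto simp: words_def)
    have "v = ?ins (v ! l) ?w" "v ! l \<in> Q"
      using vW l by (auto simp: words_def id_take_nth_drop[symmetric])
    then obtain x u where xu: "v = ?ins x u" "x = v ! l" "x \<in> Q" "u \<in> words Q n" using w by blast
    have x: "x = a \<or> x = b" using avoid[OF v] xu(2,3) ab(1) by blast
    have "?ins x u \<in> supp Q (Suc n) f" using v xu(1) by metis
    then have "?ins a u \<in> supp Q (Suc n) f" using x same[OF xu(4)] by metis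
    then have "u \<in> ?S" unfolding supp_face_iff[OF Qab(4)] using xu(4) by simp
    with x     show "v \<in> ?ins a ` ?S \<union> ?ins b ` ?S"
      unfolding xu(1) by blast
  next
    fix v assume "v \<in> ?ins a ` ?S \<union> ?ins b ` ?S"
    then show "v \<in> supp Q (Suc n) f" using same Qab(4) by (auto simp: supp_face_iff)
  qed
  moreover have "inj_on (?ins c) ?S" for c
    using ins_eq by (auto simp: inj_on_def supp_def)
  moreover have "?ins a ` ?S \<inter> ?ins b ` ?S = {}"
    using ins_eq ab(2) by (auto simp: supp_def)
  ultimately have "card (supp Q (Suc n) f) = 2 * card ?S"
    using finQ by (simp add: card_Un_disjoint card_image)
  then show thesis using that signed_face[OF f l Qab(4)] by blast
qed

section \<open>Sums of three boxes\<close>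

text \<open>Here u, v, w count the coordinates in which two given boxes agree, z those with three
  different sides; the 4 comes from a word common to all three. The gap d = n - w decides: d = 2
  gives 5/2 * 2^n - 6 or 5/2 * 2^n - 4. For d = 3 only the tuples (u, v, w, z) = (1, 1, 1, 1), (1,
  0, 1, 2), (2, 0, 2, 1) survive up to swapping u and v, with sizes 36, 38 and 78.\<close>

lemma three_boxes_arith:
  fixes s n u v w z :: nat
  assumes s: "s + 2 * (2 ^ u + 2 ^ v + 2 ^ w) = 3 * 2 ^ n + (if z = 0 then 4 else 0)"
    and n: "u + v + w + z = n" and max: "u \<le> w" "v \<le> w" "w \<ge> 1"
    and lower: "2 * 2 ^ n < s" and upper: "2 * s < 5 * 2 ^ n"
  shows "n \<ge> 4 \<and> s = 5 * 2 ^ (n - 1) - 6 \<or> n = 5 \<and> s = 78 \<or> n = 4 \<and> (s = 36 \<or> s = 38) \<or>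
    n \<ge> 4 \<and> n = w + 2 \<and> (u = 1 \<and> v = 1 \<and> z = 0 \<or> u = 0 \<and> v = 0 \<and> z = 2)"
proof -
  define d where "d = u + v + z"
  have nd: "n = w + d" using n by (simp add: d_def)
  have uv: "(2::nat) ^ u \<le> 2 ^ w" "(2::nat) ^ v \<le> 2 ^ w" using max by simp_all
  \<comment> \<open>For d >= 4 the size is at least (3 - 6/16) * 2^n, which exceeds 5/2 *
    2^n.\<close>
  have "d \<le> 3"
  proof (rule ccontr)
    assume "\<not> d \<le> 3"
    then have "(2::nat) ^ (w + 4) \<le> 2 ^ n" unfolding nd by (intro power_increasing) auto
    then have "16 * 2 ^ w \<le> (2::nat) ^ n" by (simp add: power_add)
    moreover have "0 < (2::nat) ^ w" by simp
    moreover have "3 * 2 ^ n \<le> s + 6 * 2 ^ w"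
    proof -
      have "3 * 2 ^ n \<le> s + 2 * (2 ^ u + 2 ^ v + 2 ^ w)" using s by simp
      then show ?thesis using uv unfolding distrib_left by linarith
    qed
    moreover have False if "16 * W \<le> N" "0 < W" "3 * N \<le> s + 6 * W" "2 * s < 5 * N" for W N :: nat
      using that by linarith
    ultimately show False using upper by blast
  qed
  have w: "w = 1 \<or> w = 2 \<or> w = 3 \<or> w \<ge> 4 \<and> 16 \<le> (2::nat) ^ w"
  proof -
    have "w \<ge> 4 \<and> 16 \<le> (2::nat) ^ w" if "w \<ge> 4" using that power_increasing[OF that, of "2::nat"] by simp
    then show ?thesis using max by linarith
  qed
  consider "d = 0" | "d = 1" | "d = 2" | "d = 3" using \<open>d \<le> 3\<close> by linarith
  then show ?thesis
  proof cases
    \<comment> \<open>For d <= 1 the size stays below 2 * 2^n.\<close>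
    case 1
    then have "u = 0" "v = 0" "z = 0" "n = w" using nd by (simp_all add: d_def)
    then show ?thesis using s lower by simp
  next
    case 2
    then have "u = 1 \<and> v = 0 \<and> z = 0 \<or> u = 0 \<and> v = 1 \<and> z = 0 \<or> u = 0 \<and> v = 0 \<and> z = 1"
      by (auto simp: d_def)
    then show ?thesis using s lower nd 2 by auto
  next
    case 3
    then have "u = 2 \<and> v = 0 \<and> z = 0 \<or> u = 0 \<and> v = 2 \<and> z = 0 \<or> u = 0 \<and> v = 0 \<and> z = 2 \<or>
        u = 1 \<and> v = 1 \<and> z = 0 \<or> u = 1 \<and> v = 0 \<and> z = 1 \<or> u = 0 \<and> v = 1 \<and> z = 1"
      unfolding d_def by presburger
    moreover have "n = w + 2" using nd 3 by simp
    \<comment> \<open>Otherwise w = 1 and n = 3, where the size is at most 16 = 2 * 2^3.\<close>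
    moreover from this have "n \<ge> 4"
      using w s lower calculation by auto
    ultimately show ?thesis using s by auto
  next
    case 4
    then have "u = 3 \<and> v = 0 \<and> z = 0 \<or> u = 2 \<and> v = 1 \<and> z = 0 \<or> u = 2 \<and> v = 0 \<and> z = 1 \<or>
        u = 1 \<and> v = 2 \<and> z = 0 \<or> u = 1 \<and> v = 1 \<and> z = 1 \<or> u = 1 \<and> v = 0 \<and> z = 2 \<or>
        u = 0 \<and> v = 3 \<and> z = 0 \<or> u = 0 \<and> v = 2 \<and> z = 1 \<or> u = 0 \<and> v = 1 \<and> z = 2 \<or>
        u = 0 \<and> v = 0 \<and> z = 3"
      unfolding d_def by presburger
    moreover have "n = w + 3" using nd 4 by simp
    ultimately show ?thesis using w s upper max by (elim disjE) (simp_all add: power_add)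
  qed
qed

lemma box_pairs_in_words: "set As \<subseteq> pairs Q \<Longrightarrow> w \<in> box As \<Longrightarrow> w \<in> words Q (length As)"
  by (induction As arbitrary: w) (auto simp: box_Cons pairs_def)

abbreviation coord1 :: "'b \<times> 'b \<times> 'b \<Rightarrow> 'b" where "coord1 t \<equiv> fst t"
abbreviation coord2 :: "'b \<times> 'b \<times> 'b \<Rightarrow> 'b" where "coord2 t \<equiv> fst (snd t)"
abbreviation coord3 :: "'b \<times> 'b \<times> 'b \<Rightarrow> 'b" where "coord3 t \<equiv> snd (snd t)"

definition three_boxes :: "('a set \<times> 'a set \<times> 'a set) list \<Rightarrow> 'a list set" where
  "three_boxes Ts = sym_diff (sym_diff (box (map coord1 Ts)) (box (map coord2 Ts))) (box (map coord3 Ts))"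

definition count :: "('b \<Rightarrow> bool) \<Rightarrow> 'b list \<Rightarrow> nat" where
  "count P xs = length (filter P xs)"

lemma count_simps [simp]:
  "count P [] = 0" "count P (x # xs) = (if P x then 1 else 0) + count P xs"
  "count P (xs @ ys) = count P xs + count P ys" "count P (map f xs) = count (\<lambda>x. P (f x)) xs"
  by (simp_all add: count_def o_def)

text \<open>The sizes of the theorem over the naturals: 78 = 5/2 * 2^5 - 2, 18 = 5/2 * 2^3 - 2, 40 =
  5/2 * 2^4.\<close>

definition spectrum :: "nat \<Rightarrow> nat \<Rightarrow> bool" where
  "spectrum n s \<longleftrightarrow> (\<exists>k m. n = k + m \<and> (k \<ge> 4 \<and> s = 2 ^ m * (5 * 2 ^ (k - 1) - 6) \<or>
     k = 5 \<and> s = 2 ^ m * 78 \<or> k = 3 \<and> s = 2 ^ m * 18 \<or> k = 4 \<and> s = 2 ^ m * 40))"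

lemma spectrum_double: "spectrum n s \<Longrightarrow> spectrum (Suc n) (2 * s)"
proof -
  assume "spectrum n s"
  then obtain k m where "n = k + m" and km: "k \<ge> 4 \<and> s = 2 ^ m * (5 * 2 ^ (k - 1) - 6) \<or>
     k = 5 \<and> s = 2 ^ m * 78 \<or> k = 3 \<and> s = 2 ^ m * 18 \<or> k = 4 \<and> s = 2 ^ m * 40"
    unfolding spectrum_def by blast
  then have "Suc n = k + Suc m" by simp
  moreover have "k \<ge> 4 \<and> 2 * s = 2 ^ Suc m * (5 * 2 ^ (k - 1) - 6) \<or>
     k = 5 \<and> 2 * s = 2 ^ Suc m * 78 \<or> k = 3 \<and> 2 * s = 2 ^ Suc m * 18 \<or> k = 4 \<and> 2 * s = 2 ^ Suc m * 40"
    using km by (elim disjE) (simp_all add: mult.assoc)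
  ultimately show ?thesis unfolding spectrum_def by blast
qed

text \<open>This symmetry allows the assumption that the second and third box agree most
  often.\<close>

lemma three_boxes_perm:
  "three_boxes (map (\<lambda>(a, b, c). (b, a, c)) Ts) = three_boxes Ts"
  "three_boxes (map (\<lambda>(a, b, c). (c, b, a)) Ts) = three_boxes Ts"
  unfolding three_boxes_def map_map o_def by (auto simp: case_prod_unfold)

context
  fixes Q :: "'a set"
  assumes card_Q: "card Q = 3"
begin

text \<open>Three equal sides would make the whole support miss a value in that coordinate, a case
  handled by halving.\<close>

abbreviation triples :: "('a set \<times> 'a set \<times> 'a set) set" where
  "triples \<equiv> {(a, b, c). a \<in> pairs Q \<and> b \<in> pairs Q \<and> c \<in> pairs Q \<and> \<not> (a = b \<and> b = c)}"

lemma card_triple_Int: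
  assumes "(a, b, c) \<in> triples"
  shows "card (a \<inter> b \<inter> c) = (if a \<noteq> b \<and> a \<noteq> c \<and> b \<noteq> c then 0 else 1)"
proof (cases "a \<noteq> b \<and> a \<noteq> c \<and> b \<noteq> c")
  case True
  then show ?thesis using pairs_triple_Int[OF card_Q] assms by auto
next
  case False
  have abc: "a \<in> pairs Q" "b \<in> pairs Q" "c \<in> pairs Q" using assms by simp_all
  consider "b = a" "a \<noteq> c" | "c = a" "a \<noteq> b" | "c = b" "a \<noteq> b" using False assms by auto
  then show ?thesis
  proof cases
    case 1
    then show ?thesis using card_pairs_Int[OF card_Q abc(1,3)] by simp
  next
    case 2
    moreover from 2 have "a \<inter> b \<inter> c = a \<inter> b" by blast
    ultimately show ?thesis using card_pairs_Int[OF card_Q abc(1,2)] by simp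
  next
    case 3
    moreover from 3 have "a \<inter> b \<inter> c = a \<inter> b" by blast
    ultimately show ?thesis using card_pairs_Int[OF card_Q abc(1,2)] by simp
  qed
qed

text \<open>Three pairs that are not all equal share one point, or none if they are all different;
  so the product is 1 or 0.\<close>

lemma card_box_triple_Int:
  assumes "set Ts \<subseteq> triples"
  shows "card (box (map coord1 Ts) \<inter> box (map coord2 Ts) \<inter> box (map coord3 Ts)) =
    (if count (\<lambda>(a, b, c). a \<noteq> b \<and> a \<noteq> c \<and> b \<noteq> c) Ts = 0 then 1 else 0)"
  unfolding box_map_Int card_box using assms
proof (induction Ts)
  case (Cons t Ts)
  obtain a b c where t: "t = (a, b, c)" by (cases t)
  have "prod_list (map card (map (\<lambda>t. coord1 t \<inter> coord2 t \<inter> coord3 t) Ts)) =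
    (if count (\<lambda>(a, b, c). a \<noteq> b \<and> a \<noteq> c \<and> b \<noteq> c) Ts = 0 then 1 else 0)"
    using Cons by simp
  moreover have "card (a \<inter> b \<inter> c) = (if a \<noteq> b \<and> a \<noteq> c \<and> b \<noteq> c then 0 else 1)"
    using Cons.prems t by (intro card_triple_Int) simp
  ultimately show ?case by (simp add: t)
qed simp

lemma count_partition:
  assumes "set Ts \<subseteq> triples"
  shows "count (\<lambda>(a, b, c). a = b) Ts + count (\<lambda>(a, b, c). a = c) Ts + count (\<lambda>(a, b, c). b = c) Ts +
    count (\<lambda>(a, b, c). a \<noteq> b \<and> a \<noteq> c \<and> b \<noteq> c) Ts = length Ts"
  using assms by (induction Ts) auto

lemma card_three_boxes:
  assumes Ts: "set Ts \<subseteq> triples"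
  shows "card (three_boxes Ts) + 2 * (2 ^ count (\<lambda>(a, b, c). a = b) Ts + 2 ^ count (\<lambda>(a, b, c). a = c) Ts
      + 2 ^ count (\<lambda>(a, b, c). b = c) Ts) =
    3 * 2 ^ length Ts + (if count (\<lambda>(a, b, c). a \<noteq> b \<and> a \<noteq> c \<and> b \<noteq> c) Ts = 0 then 4 else 0)"
proof -
  let ?A = "box (map coord1 Ts)" and ?B = "box (map coord2 Ts)" and ?C = "box (map coord3 Ts)"
  have sets: "set (map coord1 Ts) \<subseteq> pairs Q" "set (map coord2 Ts) \<subseteq> pairs Q" "set (map coord3 Ts) \<subseteq> pairs Q"
    using Ts by auto
  have fin: "finite ?A" "finite ?B" "finite ?C"
    using sets finite_box_pairs[OF card_Q] by blast+
  have card: "card ?A = 2 ^ length Ts" "card ?B = 2 ^ length Ts" "card ?C = 2 ^ length Ts"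
    using sets[THEN card_box_pairs[OF card_Q]] by simp_all
  have "card (?A \<inter> ?B) = 2 ^ count (\<lambda>t. coord1 t = coord2 t) Ts"
    "card (?A \<inter> ?C) = 2 ^ count (\<lambda>t. coord1 t = coord3 t) Ts"
    "card (?B \<inter> ?C) = 2 ^ count (\<lambda>t. coord2 t = coord3 t) Ts"
    unfolding count_def using Ts by (intro card_box_Int[OF card_Q]; fastforce)+
  then have int2: "card (?A \<inter> ?B) = 2 ^ count (\<lambda>(a, b, c). a = b) Ts"
    "card (?A \<inter> ?C) = 2 ^ count (\<lambda>(a, b, c). a = c) Ts"
    "card (?B \<inter> ?C) = 2 ^ count (\<lambda>(a, b, c). b = c) Ts"
    by (simp_all add: case_prod_unfold)
  have "sym_diff ?A ?B \<inter> ?C = sym_diff (?A \<inter> ?C) (?B \<inter> ?C)" by blast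
  moreover have "?A \<inter> ?C \<inter> (?B \<inter> ?C) = ?A \<inter> ?B \<inter> ?C" by blast
  \<comment> \<open>A word in all three boxes is counted 3 - 2 * 3 + 4 = 1 time.\<close>
  ultimately have "int (card (three_boxes Ts)) = int (card ?A) + int (card ?B) + int (card ?C)
      - 2 * (int (card (?A \<inter> ?B)) + int (card (?A \<inter> ?C)) + int (card (?B \<inter> ?C)))
      + 4 * int (card (?A \<inter> ?B \<inter> ?C))"
    unfolding three_boxes_def using fin
    by (simp add: card_sym_diff)
  then have "int (card (three_boxes Ts)) + 2 * (int (card (?A \<inter> ?B)) + int (card (?A \<inter> ?C)) + int (card (?B \<inter> ?C)))
      = 3 * 2 ^ length Ts + 4 * int (card (?A \<inter> ?B \<inter> ?C))"
    unfolding card by simp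
  then have "int (card (three_boxes Ts) + 2 * (card (?A \<inter> ?B) + card (?A \<inter> ?C) + card (?B \<inter> ?C)))
      = int (3 * 2 ^ length Ts + 4 * card (?A \<inter> ?B \<inter> ?C))"
    by simp
  then have "card (three_boxes Ts) + 2 * (card (?A \<inter> ?B) + card (?A \<inter> ?C) + card (?B \<inter> ?C))
      = 3 * 2 ^ length Ts + 4 * card (?A \<inter> ?B \<inter> ?C)"
    by (simp only: of_nat_eq_iff)
  then show ?thesis
    unfolding int2 card_box_triple_Int[OF Ts] by simp
qed

text \<open>Since x lies in all three sides, none of the boxes disappears; each just loses that
  side.\<close>

lemma three_boxes_face:
  assumes f: "signed Q (Suc n) f" and supp: "supp Q (Suc n) f = three_boxes (T1 @ (a, b, c) # T2)"
    and Ts: "set (T1 @ (a, b, c) # T2) \<subseteq> triples" and len: "length (T1 @ T2) = n"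
    and x: "x \<in> a" "x \<in> b" "x \<in> c"
  shows "supp Q n (face (length T1) x f) = three_boxes (T1 @ T2)"
proof (rule set_eqI)
  fix w
  have xQ: "x \<in> Q" using Ts x(1) by (auto simp: pairs_def)
  have "w \<in> words Q n" if w: "w \<in> three_boxes (T1 @ T2)"
  proof -
    have "w \<in> box (map coord1 (T1 @ T2)) \<or> w \<in> box (map coord2 (T1 @ T2)) \<or> w \<in> box (map coord3 (T1 @ T2))"
      using w unfolding three_boxes_def by blast
    moreover have "set (map coord1 (T1 @ T2)) \<subseteq> pairs Q" "set (map coord2 (T1 @ T2)) \<subseteq> pairs Q"
      "set (map coord3 (T1 @ T2)) \<subseteq> pairs Q"
      using Ts by auto
    moreover have "length (map g (T1 @ T2)) = n" for g :: "_ \<Rightarrow> 'a set" using len by simp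
    ultimately show ?thesis using box_pairs_in_words[of _ Q w] by metis
  qed
  moreover have "take (length T1) w @ x # drop (length T1) w \<in> three_boxes (T1 @ (a, b, c) # T2) \<longleftrightarrow>
      w \<in> three_boxes (T1 @ T2)" if w: "w \<in> words Q n"
  proof -
    have l: "length (take (length T1) w) = length T1" using w len by (simp add: words_def)
    have box: "take (length T1) w @ x # drop (length T1) w \<in> box (map g (T1 @ (a, b, c) # T2)) \<longleftrightarrow>
        w \<in> box (map g (T1 @ T2))" if "x \<in> g (a, b, c)" for g :: "_ \<Rightarrow> 'a set"
      using append_in_box[of "take (length T1) w" "map g T1" "drop (length T1) w" "map g T2"]
        append_in_box[of "take (length T1) w" "map g T1" "x # drop (length T1) w" "map g ((a, b, c) # T2)"]
        l that by simp
    show ?thesis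
      unfolding three_boxes_def Un_iff Diff_iff using box[of coord1] box[of coord2] box[of coord3] x
      by (simp only: fst_conv snd_conv simp_thms)
  qed
  ultimately show "w \<in> supp Q n (face (length T1) x f) \<longleftrightarrow> w \<in> three_boxes (T1 @ T2)"
    unfolding supp_face_iff[OF xQ] supp by blast
qed

lemma three_boxes_spectrum_aux:
  assumes f: "signed Q n f" and Ts: "set Ts \<subseteq> triples" "length Ts = n" "supp Q n f = three_boxes Ts"
    and lower: "2 * 2 ^ n < card (supp Q n f)" and upper: "2 * card (supp Q n f) < 5 * 2 ^ n"
    and max: "count (\<lambda>(a, b, c). a = b) Ts \<le> count (\<lambda>(a, b, c). b = c) Ts"
      "count (\<lambda>(a, b, c). a = c) Ts \<le> count (\<lambda>(a, b, c). b = c) Ts"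
      "count (\<lambda>(a, b, c). b = c) Ts \<ge> 1"
  shows "spectrum n (card (supp Q n f))"
proof -
  let ?s = "card (supp Q n f)"
  let ?u = "count (\<lambda>(a, b, c). a = b) Ts" and ?v = "count (\<lambda>(a, b, c). a = c) Ts"
    and ?w = "count (\<lambda>(a, b, c). b = c) Ts" and ?z = "count (\<lambda>(a, b, c). a \<noteq> b \<and> a \<noteq> c \<and> b \<noteq> c) Ts"
  have size: "?s + 2 * (2 ^ ?u + 2 ^ ?v + 2 ^ ?w) = 3 * 2 ^ n + (if ?z = 0 then 4 else 0)"
    using card_three_boxes[OF Ts(1)] Ts(2,3) by simp
  have part: "?u + ?v + ?w + ?z = n" using count_partition[OF Ts(1)] Ts(2) by simp
  consider "n \<ge> 4" "?s = 5 * 2 ^ (n - 1) - 6" | "n = 5" "?s = 78" | "n = 4" "?s = 36" | "n = 4" "?s = 38"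
    | "n \<ge> 4" "n = ?w + 2" "?u = 1 \<and> ?v = 1 \<and> ?z = 0 \<or> ?u = 0 \<and> ?v = 0 \<and> ?z = 2"
    using three_boxes_arith[OF size part max lower upper] by blast
  then show ?thesis
  proof cases
    case 1
    then show ?thesis unfolding spectrum_def by (intro exI[of _ n] exI[of _ 0]) simp
  next
    case 2
    then show ?thesis unfolding spectrum_def by (intro exI[of _ 5] exI[of _ 0]) simp
  next
    \<comment> \<open>36 is the doubled size 18 of dimension 3.\<close>
    case 3
    then show ?thesis unfolding spectrum_def by (intro exI[of _ 3] exI[of _ 1]) simp
  next
    \<comment> \<open>38 is 2 modulo 3, while 2^4 is 1.\<close>
    case 4
    then show ?thesis using card_supp_mod_3[OF card_Q f] by simp
  next
    \<comment> \<open>Both shapes give the size 5/2 * 2^n - 4. Fixing a coordinate with b = c at a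
      point of the intersection lowers w by one and keeps u, v, z, so the face has size 5/2 * 2^k -
      4 with k = n - 1. For Y = 2^(w-1), the residue of the support forces Y to be 2 modulo 3, that
      of the face forces it to be 1.\<close>
    case 5
    obtain t where "t \<in> set Ts" "(\<lambda>(a, b, c). b = c) t"
      using max(3) unfolding count_def
      by (metis (no_types, lifting) One_nat_def Suc_le_length_iff filter_eq_Cons_iff in_set_conv_decomp)
    then obtain T1 a b T2 where split: "Ts = T1 @ (a, b, b) # T2"
      by (auto simp: in_set_conv_decomp)
    have ab: "a \<in> pairs Q" "b \<in> pairs Q" "a \<noteq> b" using Ts(1) split by auto
    then have "card (a \<inter> b) = 1" using card_pairs_Int[OF card_Q] by simp
    then obtain x where x: "x \<in> a" "x \<in> b" by (metis IntD1 IntD2 card_1_singletonE insertI1)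
    obtain k where k: "n = Suc k" "length (T1 @ T2) = k" using Ts(2) split by simp
    have xQ: "x \<in> Q" using x ab(1) by (auto simp: pairs_def)
    let ?g = "face (length T1) x f"
    have T12: "set (T1 @ T2) \<subseteq> triples" using Ts(1) split by auto
    have "supp Q k ?g = three_boxes (T1 @ T2)"
      using three_boxes_face[of k f T1 a b b T2 x] f Ts split k x by simp
    moreover have "?w = Suc (count (\<lambda>(a, b, c). b = c) (T1 @ T2))"
      "?u = count (\<lambda>(a, b, c). a = b) (T1 @ T2)" "?v = count (\<lambda>(a, b, c). a = c) (T1 @ T2)"
      "?z = count (\<lambda>(a, b, c). a \<noteq> b \<and> a \<noteq> c \<and> b \<noteq> c) (T1 @ T2)"
      using ab(3) by (simp_all add: split)
    ultimately have size': "card (supp Q k ?g) + 2 * (2 ^ ?u + 2 ^ ?v + 2 ^ (?w - 1)) =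
        3 * 2 ^ k + (if ?z = 0 then 4 else 0)"
      using card_three_boxes[OF T12] k(2) by simp
    have g: "signed Q k ?g" using signed_face[of Q k f "length T1" x] f k xQ by simp
    define Y where "Y = (2::nat) ^ (?w - 1)"
    have W: "2 ^ ?w = 2 * Y" "2 ^ n = 8 * Y" "2 ^ k = 4 * Y"
      using 5(2) k(1) max(3) by (simp_all add: Y_def power_eq_if[of _ ?w])
    have s4: "?s + 4 = 20 * Y" using 5(3) size unfolding W by auto
    have t4: "card (supp Q k ?g) + 4 = 10 * Y" using 5(3) size' unfolding W Y_def[symmetric] by auto
    have Y: "Y mod 3 = 0 \<or> Y mod 3 = 1 \<or> Y mod 3 = 2" by linarith
    have 2: "Y mod 3 = 2" if "s + 4 = 20 * Y" "s mod 3 = 0 \<or> s mod 3 = 8 * Y mod 3" for s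
    proof -
      have "(s mod 3 + 4) mod 3 = (20 * (Y mod 3)) mod 3"
        using that(1) by (metis mod_add_left_eq mod_mult_right_eq)
      moreover have "8 * Y mod 3 = (8 * (Y mod 3)) mod 3" by (simp only: mod_mult_right_eq)
      ultimately show ?thesis using that(2) Y by auto
    qed
    have 1: "Y mod 3 = 1" if "t + 4 = 10 * Y" "t mod 3 = 0 \<or> t mod 3 = 4 * Y mod 3" for t
    proof -
      have "(t mod 3 + 4) mod 3 = (10 * (Y mod 3)) mod 3"
        using that(1) by (metis mod_add_left_eq mod_mult_right_eq)
      moreover have "4 * Y mod 3 = (4 * (Y mod 3)) mod 3" by (simp only: mod_mult_right_eq)
      ultimately show ?thesis using that(2) Y by auto
    qed
    have "Y mod 3 = 2" using 2[OF s4] card_supp_mod_3[OF card_Q f] unfolding W by blast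
    moreover have "Y mod 3 = 1" using 1[OF t4] card_supp_mod_3[OF card_Q g] unfolding W by blast
    ultimately have False by simp
    then show ?thesis ..
  qed
qed

lemma three_boxes_spectrum:
  assumes f: "signed Q n f" and Ts: "set Ts \<subseteq> triples" "length Ts = n" "supp Q n f = three_boxes Ts"
    and lower: "2 * 2 ^ n < card (supp Q n f)" and upper: "2 * card (supp Q n f) < 5 * 2 ^ n"
    and pos: "count (\<lambda>(a, b, c). b = c) Ts \<ge> 1"
  shows "spectrum n (card (supp Q n f))"
proof -
  let ?u = "count (\<lambda>(a, b, c). a = b) Ts" and ?v = "count (\<lambda>(a, b, c). a = c) Ts"
    and ?w = "count (\<lambda>(a, b, c). b = c) Ts"
  consider "?u \<le> ?w" "?v \<le> ?w" | "?u \<le> ?v" "?w \<le> ?v" | "?v \<le> ?u" "?w \<le> ?u" by linarith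
  then show ?thesis
  proof cases
    case 1
    then show ?thesis using three_boxes_spectrum_aux[OF assms(1-6)] pos by blast
  next
    case 2
    let ?T = "map (\<lambda>(a, b, c). (b, a, c)) Ts"
    have "set ?T \<subseteq> triples" using Ts(1) by auto
    moreover have "count (\<lambda>(a, b, c). a = b) ?T = ?u" "count (\<lambda>(a, b, c). a = c) ?T = ?w"
      "count (\<lambda>(a, b, c). b = c) ?T = ?v"
      by (simp_all add: case_prod_unfold eq_commute)
    ultimately show ?thesis
      using three_boxes_spectrum_aux[OF f, of ?T] three_boxes_perm(1)[of Ts] Ts lower upper 2 pos by simp
  next
    case 3
    let ?T = "map (\<lambda>(a, b, c). (c, b, a)) Ts"
    have "set ?T \<subseteq> triples" using Ts(1) by auto
    moreover have "count (\<lambda>(a, b, c). a = b) ?T = ?w" "count (\<lambda>(a, b, c). a = c) ?T = ?v"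
      "count (\<lambda>(a, b, c). b = c) ?T = ?u"
      by (simp_all add: case_prod_unfold eq_commute)
    ultimately show ?thesis
      using three_boxes_spectrum_aux[OF f, of ?T] three_boxes_perm(2)[of Ts] Ts lower upper 3 pos by simp
  qed
qed

end

section \<open>The spectrum\<close>

context
  fixes Q :: "'a set"
  assumes card_Q: "card Q = 3"
begin

text \<open>A coarse hull that remembers only the sides common to both boxes; it is used to bound
  the overlap of two layers.\<close>

lemma two_boxes_subset:
  assumes "set Ps \<subseteq> pairs Q \<times> pairs Q"
  shows "sym_diff (box (map fst Ps)) (box (map snd Ps)) \<subseteq>
    box (map (\<lambda>(a, b). if a = b then a else Q) Ps)"
proof -
  have *: "\<And>i. i < length Ps \<Longrightarrow> fst (Ps ! i) \<subseteq> Q \<and> snd (Ps ! i) \<subseteq> Q"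
    using assms nth_mem unfolding pairs_def by fastforce
  have "box (map fst Ps) \<subseteq> box (map (\<lambda>(a, b). if a = b then a else Q) Ps)"
    by (rule box_mono) (use * in \<open>auto simp: case_prod_unfold\<close>)
  moreover have "box (map snd Ps) \<subseteq> box (map (\<lambda>(a, b). if a = b then a else Q) Ps)"
    by (rule box_mono) (use * in \<open>auto simp: case_prod_unfold\<close>)
  ultimately show ?thesis by blast
qed

text \<open>A coordinate on which both pairs of boxes are constant contributes at most one value, one on which
  exactly one of them is constant contributes two values, and the remaining ones \<open>3 \<le> 2 \<cdot> 2\<close>.\<close>

lemma card_two_boxes_Int_le:
  assumes Rs: "set Rs \<subseteq> (pairs Q \<times> pairs Q) \<times> (pairs Q \<times> pairs Q)"
    and differ: "\<And>a b c d. ((a, b), (c, d)) \<in> set Rs \<Longrightarrow> \<not> (a = b \<and> b = c \<and> c = d)"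
  shows "card (sym_diff (box (map fst (map fst Rs))) (box (map snd (map fst Rs))) \<inter>
      sym_diff (box (map fst (map snd Rs))) (box (map snd (map snd Rs)))) \<le>
    2 ^ count (\<lambda>(a, b). a \<noteq> b) (map fst Rs) * 2 ^ count (\<lambda>(a, b). a \<noteq> b) (map snd Rs)"
proof -
  define cover :: "'a set \<times> 'a set \<Rightarrow> 'a set" where "cover = (\<lambda>(a, b). if a = b then a else Q)"
  let ?f = "\<lambda>t. cover (fst t) \<inter> cover (snd t)"
  have "set (map fst Rs) \<subseteq> pairs Q \<times> pairs Q" "set (map snd Rs) \<subseteq> pairs Q \<times> pairs Q"
    using Rs by auto
  from this[THEN two_boxes_subset, folded cover_def]
  have "sym_diff (box (map fst (map fst Rs))) (box (map snd (map fst Rs))) \<inter>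
      sym_diff (box (map fst (map snd Rs))) (box (map snd (map snd Rs))) \<subseteq>
      box (map (\<lambda>t. cover (fst t)) Rs) \<inter> box (map (\<lambda>t. cover (snd t)) Rs)"
    by (auto simp: o_def)
  then have sub: "sym_diff (box (map fst (map fst Rs))) (box (map snd (map fst Rs))) \<inter>
      sym_diff (box (map fst (map snd Rs))) (box (map snd (map snd Rs))) \<subseteq> box (map ?f Rs)"
    unfolding box_map_Int .
  have cover: "cover t \<subseteq> Q" if "t \<in> pairs Q \<times> pairs Q" for t
    using that by (auto simp: cover_def pairs_def split: if_splits)
  have "finite (box (map ?f Rs))"
  proof (rule finite_box)
    fix A assume "A \<in> set (map ?f Rs)"
    then obtain t where "t \<in> set Rs" "A = ?f t" by auto
    moreover from this have "cover (fst t) \<subseteq> Q" using Rs by (intro cover) (auto simp: mem_Times_iff)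
    ultimately have "A \<subseteq> Q" by (simp add: le_infI1)
    then show "finite A" using finite_Q[OF card_Q] finite_subset by blast
  qed
  from card_mono[OF this sub] have "card (sym_diff (box (map fst (map fst Rs))) (box (map snd (map fst Rs))) \<inter>
      sym_diff (box (map fst (map snd Rs))) (box (map snd (map snd Rs)))) \<le> prod_list (map card (map ?f Rs))"
    unfolding card_box .
  also have "\<dots> \<le> 2 ^ count (\<lambda>(a, b). a \<noteq> b) (map fst Rs) * 2 ^ count (\<lambda>(a, b). a \<noteq> b) (map snd Rs)"
    using Rs differ
  proof (induction Rs)
    case (Cons t Rs)
    obtain a b c d where t: "t = ((a, b), (c, d))" by (metis prod.exhaust)
    have abcd: "a \<in> pairs Q" "b \<in> pairs Q" "c \<in> pairs Q" "d \<in> pairs Q" and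
      ne: "\<not> (a = b \<and> b = c \<and> c = d)"
      using Cons.prems(1) Cons.prems(2)[of a b c d] by (auto simp: t)
    have Int: "a \<inter> Q = a" "Q \<inter> c = c" using abcd by (auto simp: pairs_def)
    have "card (?f t) \<le> (if a = b then 1 else 2) * (if c = d then 1 else 2)"
      using ne abcd Int card_pairs_Int[OF card_Q abcd(1,3)] pairsD[OF card_Q abcd(1)] pairsD[OF card_Q abcd(3)]
        card_Q by (auto simp: t cover_def)
    moreover have "prod_list (map card (map ?f Rs)) \<le>
        2 ^ count (\<lambda>(a, b). a \<noteq> b) (map fst Rs) * 2 ^ count (\<lambda>(a, b). a \<noteq> b) (map snd Rs)"
      using Cons.IH Cons.prems by (meson list.set_intros(2) set_subset_Cons order_trans)
    ultimately have "card (?f t) * prod_list (map card (map ?f Rs)) \<le>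
        ((if a = b then 1 else 2) * (if c = d then 1 else 2)) *
        (2 ^ count (\<lambda>(a, b). a \<noteq> b) (map fst Rs) * 2 ^ count (\<lambda>(a, b). a \<noteq> b) (map snd Rs))"
      by (rule mult_le_mono)
    then show ?case by (simp add: t split: if_splits)
  qed simp
  finally show ?thesis .
qed

text \<open>Here s = (5 * 2^i - 2) * 2^k. For odd i the first factor is 2 modulo 3 while 2^(i+1) is
  1, against the residue; i = 2 and i = 4 give 18 and 78, doubled k times.\<close>

lemma two_boxes_arith:
  fixes s k i n :: nat
  assumes s: "s + 2 * 2 ^ k = 5 * 2 ^ (k + i)" and i: "2 \<le> i" "i < 6"
    and mod3: "s mod 3 = 0 \<or> s mod 3 = 2 ^ (k + i + 1) mod 3"
  shows "spectrum (k + i + 1) s"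
proof -
  define X where "X = (2::nat) ^ k"
  have X: "X mod 3 = 1 \<or> X mod 3 = 2"
    unfolding X_def by (induction k) (auto simp: mod_mult_right_eq[of 2 "2 ^ _" 3, symmetric])
  have s': "s + 2 * X = 5 * 2 ^ i * X" using s by (simp add: X_def power_add)
  have m: "s mod 3 = 0 \<or> s mod 3 = (2 * 2 ^ i * X) mod 3"
    using mod3 by (simp add: X_def power_add mult.commute mult.left_commute)
  consider "i = 2" | "i = 3" | "i = 4" | "i = 5" using i by linarith
  then show ?thesis
  proof cases
    case 1
    then have "s = 2 ^ k * 18" using s' by (simp add: X_def)
    then show ?thesis unfolding spectrum_def 1 by (intro exI[of _ 3] exI[of _ k]) simp
  next
    case 2
    then have "s = 38 * X" using s' by simp
    then have "s mod 3 = (2 * (X mod 3)) mod 3" by (simp add: mod_mult_cong[of 38 3 2 X X] mod_mult_right_eq)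
    moreover have "(16 * X) mod 3 = X mod 3" by (simp add: mod_mult_cong[of 16 3 1 X X])
    ultimately show ?thesis using m X 2 by auto
  next
    case 3
    then have "s = 2 ^ k * 78" using s' by (simp add: X_def)
    then show ?thesis unfolding spectrum_def 3 by (intro exI[of _ 5] exI[of _ k]) simp
  next
    case 4
    then have "s = 158 * X" using s' by simp
    then have "s mod 3 = (2 * (X mod 3)) mod 3" by (simp add: mod_mult_cong[of 158 3 2 X X] mod_mult_right_eq)
    moreover have "(64 * X) mod 3 = X mod 3" by (simp add: mod_mult_cong[of 64 3 1 X X])
    ultimately show ?thesis using m X 4 by auto
  qed
qed

lemma mult_power_less_imp:
  fixes a b :: nat
  assumes "a * 2 ^ n < b * 2 ^ k" "b \<le> a * 2 ^ j"
  shows "n < k + j"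
proof (rule ccontr)
  assume "\<not> n < k + j"
  then have "2 ^ (k + j) \<le> (2::nat) ^ n" by (intro power_increasing) auto
  then have "a * 2 ^ (k + j) < b * 2 ^ k" using assms(1) by (meson le_less_trans mult_le_mono2)
  then have "a * 2 ^ j < b" by (simp add: power_add mult.assoc[symmetric] mult.commute[of "2 ^ k"])
  then show False using assms(2) by simp
qed

lemma count_neq: "count (\<lambda>(a, b). a \<noteq> b) Ps + length (filter (\<lambda>(a, b). a = b) Ps) = length Ps"
  by (induction Ps) auto

lemma supp_spectrum:
  "signed Q n f \<Longrightarrow> 2 * 2 ^ n < card (supp Q n f) \<Longrightarrow> 2 * card (supp Q n f) < 5 * 2 ^ n \<Longrightarrow>
    spectrum n (card (supp Q n f))"
proof (induction n arbitrary: f)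
  case 0
  have "card (supp Q 0 f) \<le> card {[] :: 'a list}" by (rule card_mono) (auto simp: supp_def)
  then show ?case using 0 by simp
next
  case (Suc n)
  let ?s = "card (supp Q (Suc n) f)"
  show ?case
  proof (cases "\<exists>l\<le>n. \<exists>q\<in>Q. \<forall>w\<in>supp Q (Suc n) f. w ! l \<noteq> q")
    case True
    then obtain g where "signed Q n g" "?s = 2 * card (supp Q n g)"
      using supp_avoiding_value[OF card_Q Suc.prems(1)] by metis
    then show ?thesis using Suc.IH[of g] Suc.prems(2,3) spectrum_double[of n "card (supp Q n g)"] by simp
  next
    case False
    then have full: "\<exists>w\<in>supp Q (Suc n) f. w ! l = q" if "l \<le> n" "q \<in> Q" for l q
      using that by blast
    obtain p q r where Q: "Q = {p, q, r}" "p \<noteq> q" "p \<noteq> r" "q \<noteq> r"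
      and le: "card (supp Q n (\<lambda>w. f (p # w))) \<le> card (supp Q n (\<lambda>w. f (q # w)))"
        "card (supp Q n (\<lambda>w. f (q # w))) \<le> card (supp Q n (\<lambda>w. f (r # w)))"
      and sum: "?s = card (supp Q n (\<lambda>w. f (p # w))) +
        card (supp Q n (\<lambda>w. f (q # w))) + card (supp Q n (\<lambda>w. f (r # w)))"
      using sorted_layers[OF card_Q Suc.prems(1)] by metis
    let ?Sp = "supp Q n (\<lambda>w. f (p # w))" and ?Sq = "supp Q n (\<lambda>w. f (q # w))"
      and ?Sr = "supp Q n (\<lambda>w. f (r # w))"
    have sg: "signed Q n (\<lambda>w. f (p # w))" "signed Q n (\<lambda>w. f (q # w))" "signed Q n (\<lambda>w. f (r # w))"
      by (rule signed_layer[OF Suc.prems(1)]; use Q(1) in blast)+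
    have QI: "q \<in> Q" "r \<in> Q" "p \<in> Q" using Q(1) by simp_all
    have Sr: "?Sr = sym_diff ?Sp ?Sq" using layer_r[OF card_Q Suc.prems(1) Q] .
    have "finite ?Sp" "finite ?Sq" using finite_Q[OF card_Q] by simp_all
    then have card_Sr: "int (card ?Sr) = int (card ?Sp) + int (card ?Sq) - 2 * int (card (?Sp \<inter> ?Sq))"
      unfolding Sr by (rule card_sym_diff)
    have "?Sp \<noteq> {}"
    proof -
      obtain w where w: "w \<in> supp Q (Suc n) f" "w ! 0 = p" using full[of 0 p] QI by auto
      then have "w \<in> words Q (Suc n)" by (simp add: supp_def)
      then obtain x v where "w = x # v" by (rule words_SucE)
      then show ?thesis using w by auto
    qed
    have up: "?s < 5 * 2 ^ n" and low: "4 * 2 ^ n < ?s" using Suc.prems(2,3) by simp_all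
    have Sp_small: "3 * card ?Sp < 5 * 2 ^ n" using sum le up by linarith
    then have "card ?Sp < 2 * 2 ^ n" by simp
    then show ?thesis
    proof (cases rule: small_supp_cases[OF card_Q sg(1), consumes 1, case_names empty box two])
      case empty
      then show ?thesis using \<open>?Sp \<noteq> {}\<close> by simp
    next
      case (box As)
      then have "card ?Sp = 2 ^ n" using card_box_pairs[OF card_Q] by metis
      then have "card ?Sq < 2 * 2 ^ n" using sum le up by linarith
      then show ?thesis
      proof (cases rule: small_supp_cases[OF card_Q sg(2), consumes 1, case_names empty box two])
        case empty
        then show ?thesis using le(1) \<open>card ?Sp = 2 ^ n\<close> by simp
      next
        \<comment> \<open>Two box layers give s = 4 * 2^n - 2 * card
          (\<open>?Sp \<inter> ?Sq\<close>), which is too small.\<close>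
        case (box Bs)
        then have "card ?Sq = 2 ^ n" using card_box_pairs[OF card_Q] by metis
        then show ?thesis using \<open>card ?Sp = 2 ^ n\<close> card_Sr sum low by linarith
      next
        case (two Ps)
        \<comment> \<open>A box of the layer p reappears in the layer r, hence the side {p, r};
          likewise {q, r} for the two boxes of the layer q. This first triple is the agreement b = c
          that \<open>three_boxes_spectrum\<close> asks for.\<close>
        let ?Ts = "({p, r}, {q, r}, {q, r}) # zip As Ps"
        have len: "length As = length Ps" using box two by simp
        have maps: "map coord1 (zip As Ps) = As" "map coord2 (zip As Ps) = map fst Ps"
          "map coord3 (zip As Ps) = map snd Ps"
          using len by (simp_all add: list_eq_iff_nth_eq)
        have supp: "supp Q (Suc n) f = three_boxes ?Ts"
        proof (rule supp_Suc_eqI[OF card_Q Suc.prems(1) Q])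
        qed (use box two Q(2-4) QI in \<open>auto simp: three_boxes_def maps dest: length_box\<close>)
        have "{p, r} \<noteq> {q, r}" using Q(2-4) by auto
        have PQ: "set ?Ts \<subseteq> pairs Q \<times> pairs Q \<times> pairs Q"
          using box(1) two(1) pairs_of_distinct[OF card_Q Q] by (auto dest: set_zip_leftD set_zip_rightD)
        \<comment> \<open>Three equal sides would keep all words away from the value outside a,
          contrary to \<open>full\<close>.\<close>
        have "\<not> (a = b \<and> b = c)" if t: "(a, b, c) \<in> set ?Ts" for a b c
        proof
          assume abc: "a = b \<and> b = c"
          obtain l where l: "l < length ?Ts" "?Ts ! l = (a, b, c)" using t by (metis in_set_conv_nth)
          have "a \<in> pairs Q" using PQ t by auto
          then obtain x where x: "x \<in> Q" "x \<notin> a" using pairs_eq_Diff[OF card_Q] by blast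
          have "l \<le> n" using l(1) two(2) box(2) by simp
          then obtain w where w: "w \<in> supp Q (Suc n) f" "w ! l = x" using full x(1) by blast
          have "w \<in> box (map coord1 ?Ts) \<or> w \<in> box (map coord2 ?Ts) \<or> w \<in> box (map coord3 ?Ts)"
            using w(1) unfolding supp three_boxes_def by blast
          then have "w ! l \<in> map coord1 ?Ts ! l \<or> w ! l \<in> map coord2 ?Ts ! l \<or> w ! l \<in> map coord3 ?Ts ! l"
            using nth_box[of w _ l] l(1) by (metis length_map)
          then have "w ! l \<in> a" unfolding nth_map[OF l(1)] l(2) using abc by simp
          then show False using w(2) x(2) by simp
        qed
        then have "set ?Ts \<subseteq> {(a, b, c). a \<in> pairs Q \<and> b \<in> pairs Q \<and> c \<in> pairs Q \<and> \<not> (a = b \<and> b = c)}"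
          using PQ by blast
        then show ?thesis
          using three_boxes_spectrum[OF card_Q Suc.prems(1) _ _ supp Suc.prems(2,3)] box(2) two(2) by simp
      qed
    next
      case (two Ps)
      let ?k = "length (filter (\<lambda>(a, b). a = b) Ps)"
      have cp: "int (card ?Sp) = 2 * 2 ^ n - 2 * 2 ^ ?k"
        using card_sym_diff_boxes[OF card_Q two(1)] two(2,4) by simp
      \<comment> \<open>A relative size below 5/3 means 2^n < 6 * 2^k, so the boxes differ in
        exactly two coordinates.\<close>
      have "int (3 * card ?Sp) < int (5 * 2 ^ n)" using Sp_small by (simp only: of_nat_less_iff)
      then have "int (1 * 2 ^ n) < int (6 * 2 ^ ?k)" using cp by simp
      then have "n < ?k + 3" using mult_power_less_imp[of 1 n 6 ?k 3] by (simp only: of_nat_less_iff) simp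
      then have k: "n = ?k + 2" using two(3) by simp
      have Sp: "2 * int (card ?Sp) = 3 * 2 ^ n" using cp k by (simp add: power_add)
      then have "int (2 * card ?Sp) = int (3 * 2 ^ n)" by simp
      then have Sp_nat: "2 * card ?Sp = 3 * 2 ^ n" by (simp only: of_nat_eq_iff)
      \<comment> \<open>The layer q has at most half of what remains, (5 - 3/2) * 2^n. Being below
        7/4, the next possible relative size, it is 3/2 as well.\<close>
      have Sq_small: "4 * card ?Sq < 7 * 2 ^ n" using Sp_nat sum le up by linarith
      then have "card ?Sq < 2 * 2 ^ n" by simp
      then show ?thesis
      proof (cases rule: small_supp_cases[OF card_Q sg(2), consumes 1, case_names empty box two])
        case empty
        then show ?thesis using le(1) Sp by simp
      next
        case (box Bs)
        then have "card ?Sq = 2 ^ n" using card_box_pairs[OF card_Q] by metis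
        moreover have "0 < (2::nat) ^ n" by simp
        ultimately show ?thesis using le(1) Sp_nat by linarith
      next
        case two': (two Ps')
        let ?k' = "length (filter (\<lambda>(a, b). a = b) Ps')"
        have cq: "int (card ?Sq) = 2 * 2 ^ n - 2 * 2 ^ ?k'"
          using card_sym_diff_boxes[OF card_Q two'(1)] two'(2,4) by simp
        have "int (4 * card ?Sq) < int (7 * 2 ^ n)" using Sq_small by (simp only: of_nat_less_iff)
        then have "int (1 * 2 ^ n) < int (8 * 2 ^ ?k')" using cq by simp
        then have "n < ?k' + 3" using mult_power_less_imp[of 1 n 8 ?k' 3] by (simp only: of_nat_less_iff) simp
        then have k': "n = ?k' + 2" using two'(3) by simp
        have Sq: "2 * int (card ?Sq) = 3 * 2 ^ n" using cq k' by (simp add: power_add)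
        then have "int (2 * card ?Sq) = int (3 * 2 ^ n)" by simp
        then have Sq_nat: "2 * card ?Sq = 3 * 2 ^ n" by (simp only: of_nat_eq_iff)
        \<comment> \<open>5 - 3/2 - 3/2 = 2, so the largest layer falls under the classification
          too.\<close>
        have "card ?Sr < 2 * 2 ^ n" using Sp_nat Sq_nat sum up by linarith
        then show ?thesis
        proof (cases rule: small_supp_cases[OF card_Q sg(3), consumes 1, case_names empty box two])
          case empty
          then show ?thesis using le(2) Sq by simp
        next
          case (box Cs)
          then have "card ?Sr = 2 ^ n" using card_box_pairs[OF card_Q] by metis
          moreover have "0 < (2::nat) ^ n" by simp
          ultimately show ?thesis using le(2) Sq_nat by linarith
        next
          case two'': (two Ps'')
          let ?k'' = "length (filter (\<lambda>(a, b). a = b) Ps'')"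
          have cr: "int (card ?Sr) = 2 * 2 ^ n - 2 * 2 ^ ?k''"
            using card_sym_diff_boxes[OF card_Q two''(1)] two''(2,4) by simp
          \<comment> \<open>The number of coordinates in which the two boxes of the layer r
            differ.\<close>
          define i where "i = n - ?k''"
          have n: "n = ?k'' + i" and i: "2 \<le> i" using two''(3) by (simp_all add: i_def)
          have "int (?s + 2 * 2 ^ ?k'') = int (5 * 2 ^ (?k'' + i))"
            using cr sum Sp Sq n by simp
          then have s: "?s + 2 * 2 ^ ?k'' = 5 * 2 ^ (?k'' + i)" by (simp only: of_nat_eq_iff)
          \<comment> \<open>For i >= 6 also n >= 6, so the overlap of the layers p and q exceeds
            2^(n-1) >= 32. But in each of these layers the two boxes differ in exactly two
            coordinates, which bounds the overlap by 2^2 * 2^2 = 16.\<close>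
          have "i < 6"
          proof (rule ccontr)
            assume "\<not> i < 6"
            then have "(2::int) ^ 6 \<le> 2 ^ n" unfolding n by (intro power_increasing) auto
            moreover have "2 ^ n < 2 * int (card (?Sp \<inter> ?Sq))"
            proof -
              have "2 * int (card (?Sp \<inter> ?Sq)) = 2 ^ n + 2 * 2 ^ ?k''" using card_Sr cr Sp Sq by linarith
              then show ?thesis by simp
            qed
            ultimately have "16 < card (?Sp \<inter> ?Sq)" by simp
            moreover have "card (?Sp \<inter> ?Sq) \<le> 16"
            proof -
              let ?Rs = "zip Ps Ps'"
              have maps: "map fst ?Rs = Ps" "map snd ?Rs = Ps'" using two(2) two'(2) by simp_all
              have sub: "set ?Rs \<subseteq> (pairs Q \<times> pairs Q) \<times> (pairs Q \<times> pairs Q)"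
              proof
                fix t assume "t \<in> set ?Rs"
                then have "fst t \<in> set Ps" "snd t \<in> set Ps'"
                  by (metis set_zip_leftD prod.collapse, metis set_zip_rightD prod.collapse)
                then show "t \<in> (pairs Q \<times> pairs Q) \<times> (pairs Q \<times> pairs Q)"
                  using two(1) two'(1) by (auto simp: mem_Times_iff)
              qed
              have ne: "\<not> (a = b \<and> b = c \<and> c = d)" if t: "((a, b), (c, d)) \<in> set ?Rs" for a b c d
              proof
                assume abcd: "a = b \<and> b = c \<and> c = d"
                obtain l where "l < length ?Rs" "?Rs ! l = ((a, b), (c, d))" using t by (metis in_set_conv_nth)
                then have l: "l < n" "Ps ! l = (a, a)" "Ps' ! l = (a, a)" using abcd two(2) two'(2) by simp_all
                have "a \<in> pairs Q" using sub t by auto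
                then obtain x where x: "x \<in> Q" "x \<notin> a" using pairs_eq_Diff[OF card_Q] by blast
                \<comment> \<open>Coordinate l of a layer is coordinate l + 1 of f. The layer r lies
                  in the union of the other two, so a side common to both would confine all three
                  layers.\<close>
                obtain w where w: "w \<in> supp Q (Suc n) f" "w ! Suc l = x" using full[of "Suc l" x] x(1) l(1) by auto
                then have "w \<in> words Q (Suc n)" by (simp add: supp_def)
                then obtain y v where v: "w = y # v" by (rule words_SucE)
                have "v \<in> ?Sp \<union> ?Sq" using w(1) Q(1) Sr unfolding v by auto
                then have "v \<in> box (map fst Ps) \<or> v \<in> box (map snd Ps) \<or> v \<in> box (map fst Ps') \<or> v \<in> box (map snd Ps')"
                  unfolding two(4) two'(4) by blast
                then have "v ! l \<in> map fst Ps ! l \<or> v ! l \<in> map snd Ps ! l \<or> v ! l \<in> map fst Ps' ! l \<or> v ! l \<in> map snd Ps' ! l"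
                  using nth_box[of v _ l] l(1) two(2) two'(2) by (metis length_map)
                then have "v ! l \<in> a" using l two(2) two'(2) by simp
                then show False using w(2) x(2) v by simp
              qed
              have "count (\<lambda>(a, b). a \<noteq> b) Ps = 2" "count (\<lambda>(a, b). a \<noteq> b) Ps' = 2"
                using count_neq[of Ps] count_neq[of Ps'] k k' two(2) two'(2) by linarith+
              then show ?thesis
                using card_two_boxes_Int_le[OF sub ne] unfolding maps two(4)[symmetric] two'(4)[symmetric] by simp
            qed
            ultimately show False by simp
          qed
          moreover have "?s mod 3 = 0 \<or> ?s mod 3 = 2 ^ (?k'' + i + 1) mod 3"
            using card_supp_mod_3[OF card_Q Suc.prems(1)] n by simp
          ultimately show ?thesis using two_boxes_arith[OF s i] n by simp
        qed
      qed
    qed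
  qed
qed

section \<open>The endpoint of the range and the realisation of the spectrum\<close>

lemma card_supp_le:
  "signed Q (Suc n) f \<Longrightarrow> card (supp Q (Suc n) f) \<le> 2 * 3 ^ n"
proof (induction n arbitrary: f)
  case 0
  obtain p q r where Q: "Q = {p, q, r}" "p \<noteq> q" "p \<noteq> r" "q \<noteq> r"
    using card_3_obtain[OF card_Q] .
  have le: "card (supp Q 0 g) \<le> card {[] :: 'a list}" for g
    by (rule card_mono) (auto simp: supp_def)
  have "supp Q 0 (\<lambda>w. f (r # w)) =
      sym_diff (supp Q 0 (\<lambda>w. f (p # w))) (supp Q 0 (\<lambda>w. f (q # w)))"
    using layer_r[OF card_Q 0 Q] .
  then have "card (supp Q 0 (\<lambda>w. f (r # w))) = 0 \<or> card (supp Q 0 (\<lambda>w. f (p # w))) = 0 \<or>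
      card (supp Q 0 (\<lambda>w. f (q # w))) = 0"
    by (auto simp: supp_def)
  moreover have "card (supp Q (Suc 0) f) = card (supp Q 0 (\<lambda>w. f (p # w))) +
      card (supp Q 0 (\<lambda>w. f (q # w))) + card (supp Q 0 (\<lambda>w. f (r # w)))"
    unfolding card_supp_Suc[OF finite_Q[OF card_Q]] using Q by (simp add: add.assoc)
  ultimately show ?case using le[of "\<lambda>w. f (p # w)"] le[of "\<lambda>w. f (q # w)"] le[of "\<lambda>w. f (r # w)"] by auto
next
  case (Suc n)
  have "card (supp Q (Suc (Suc n)) f) = (\<Sum>x\<in>Q. card (supp Q (Suc n) (\<lambda>w. f (x # w))))"
    by (rule card_supp_Suc[OF finite_Q[OF card_Q]])
  also have "\<dots> \<le> of_nat (card Q) * (2 * 3 ^ n)"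
    by (rule sum_bounded_above) (use Suc.IH signed_layer[OF Suc.prems] in blast)
  finally show ?case by (simp add: card_Q)
qed

lemma supp_spectrum_le:
  assumes f: "signed Q (Suc n) f" and "4 * 2 ^ n < card (supp Q (Suc n) f)" "card (supp Q (Suc n) f) \<le> 5 * 2 ^ n"
  shows "spectrum (Suc n) (card (supp Q (Suc n) f))"
proof (cases "card (supp Q (Suc n) f) = 5 * 2 ^ n")
  case True
  \<comment> \<open>In dimension n + 1 <= 3 the bound 2 * 3^n, from at most two nonzero values per
    line, is below 5 * 2^n.\<close>
  have "n \<ge> 3"
  proof (rule ccontr)
    assume "\<not> n \<ge> 3"
    then have "n = 0 \<or> n = 1 \<or> n = 2" by linarith
    then show False using card_supp_le[OF f] True by auto
  qed
  then obtain m where m: "n = m + 3" by (metis add.commute le_Suc_ex)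
  then show ?thesis
    unfolding True spectrum_def by (intro exI[of _ 4] exI[of _ m]) (simp add: power_add)
next
  case False
  then show ?thesis using supp_spectrum[OF f] assms by simp
qed

lemma spectrum_attained:
  assumes "spectrum n s"
  shows "\<exists>f. signed Q n f \<and> card (supp Q n f) = s"
proof -
  obtain k m where n: "n = k + m" and km: "k \<ge> 4 \<and> s = 2 ^ m * (5 * 2 ^ (k - 1) - 6) \<or>
     k = 5 \<and> s = 2 ^ m * 78 \<or> k = 3 \<and> s = 2 ^ m * 18 \<or> k = 4 \<and> s = 2 ^ m * 40"
    using assms unfolding spectrum_def by blast
  from km have "tree_size n s"
  proof (elim disjE conjE)
    assume "k \<ge> 4" "s = 2 ^ m * (5 * 2 ^ (k - 1) - 6)"
    then show ?thesis unfolding n using tree_size_double[OF tree_size_family[of k], of m] by simp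
  next
    assume "k = 5" "s = 2 ^ m * 78"
    then show ?thesis unfolding n using tree_size_double[OF tree_size_78] by blast
  next
    assume "k = 3" "s = 2 ^ m * 18"
    then show ?thesis unfolding n using tree_size_double[OF tree_size_18] by blast
  next
    assume "k = 4" "s = 2 ^ m * 40"
    then show ?thesis unfolding n using tree_size_double[OF tree_size_40] by blast
  qed
  then show ?thesis using signed_of_tree[OF card_Q] unfolding tree_size_def by blast
qed

end

section \<open>Passage to real arithmetic and the final equivalence\<close>

lemma spectrum_iff_real:
  fixes s :: nat
  shows "spectrum N s \<longleftrightarrow>
    (\<exists>n m :: nat. n \<ge> 1 \<and> N = n + m \<and>
      (n \<ge> 4 \<and> real s = 2 ^ m * (5 / 2 * 2 ^ n - 6) \<or>
       n = 5 \<and> real s = 2 ^ m * (5 / 2 * 2 ^ 5 - 2) \<or>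
       n = 3 \<and> real s = 2 ^ m * (5 / 2 * 2 ^ 3 - 2) \<or>
       n = 4 \<and> real s = 2 ^ m * (5 / 2 * 2 ^ 4)))"
proof -
  have 1: "s = 2 ^ m * (5 * 2 ^ (n - 1) - 6) \<longleftrightarrow> real s = 2 ^ m * (5 / 2 * 2 ^ n - 6)" if "n \<ge> 4" for n m :: nat
  proof -
    \<comment> \<open>This makes the natural subtraction of 6 exact.\<close>
    have "(2::nat) ^ 3 \<le> 2 ^ (n - 1)" using that by (intro power_increasing) auto
    then have "real (2 ^ m * (5 * 2 ^ (n - 1) - 6)) = 2 ^ m * (5 * 2 ^ (n - 1) - 6)"
      by (simp add: of_nat_diff)
    also have "5 * 2 ^ (n - 1) = 5 / 2 * (2::real) ^ n" using that by (simp add: power_eq_if[of _ n])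
    finally show ?thesis by (metis of_nat_eq_iff)
  qed
  have 2: "s = 2 ^ m * c \<longleftrightarrow> real s = 2 ^ m * real c" for m c :: nat
    unfolding of_nat_eq_iff[of s "2 ^ m * c", where 'a = real, symmetric] by simp
  define P where "P n m \<longleftrightarrow> (n \<ge> 4 \<and> real s = 2 ^ m * (5 / 2 * 2 ^ n - 6) \<or>
       n = 5 \<and> real s = 2 ^ m * (5 / 2 * 2 ^ 5 - 2) \<or>
       n = 3 \<and> real s = 2 ^ m * (5 / 2 * 2 ^ 3 - 2) \<or>
       n = 4 \<and> real s = 2 ^ m * (5 / 2 * 2 ^ 4))" for n m :: nat
  have "spectrum N s \<longleftrightarrow> (\<exists>n m. N = n + m \<and> P n m)"
  proof -
    have "(n \<ge> 4 \<and> s = 2 ^ m * (5 * 2 ^ (n - 1) - 6) \<or> n = 5 \<and> s = 2 ^ m * 78 \<or>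
        n = 3 \<and> s = 2 ^ m * 18 \<or> n = 4 \<and> s = 2 ^ m * 40) \<longleftrightarrow> P n m" for n m
    proof -
      have "n \<ge> 4 \<and> s = 2 ^ m * (5 * 2 ^ (n - 1) - 6) \<longleftrightarrow> n \<ge> 4 \<and> real s = 2 ^ m * (5 / 2 * 2 ^ n - 6)"
        using 1 by blast
      moreover have "s = 2 ^ m * 78 \<longleftrightarrow> real s = 2 ^ m * (5 / 2 * 2 ^ 5 - 2)"
        "s = 2 ^ m * 18 \<longleftrightarrow> real s = 2 ^ m * (5 / 2 * 2 ^ 3 - 2)"
        "s = 2 ^ m * 40 \<longleftrightarrow> real s = 2 ^ m * (5 / 2 * 2 ^ 4)"
        unfolding 2 by simp_all
      ultimately show ?thesis unfolding P_def by metis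
    qed
    then show ?thesis unfolding spectrum_def by presburger
  qed
  also have "\<dots> \<longleftrightarrow> (\<exists>n m. n \<ge> 1 \<and> N = n + m \<and> P n m)"
  proof -
    have "n \<ge> 1" if "P n m" for n m using that by (auto simp: P_def)
    then show ?thesis by blast
  qed
  finally show ?thesis unfolding P_def .
qed

theorem mainTheorem4:
  fixes Q :: "'a set" and N :: nat and s :: int
  assumes "card Q = 3"
    and "N \<ge> 1"
    and "2 ^ (N + 1) < s" and "s \<le> 5 * 2 ^ (N - 1)"
  shows "(\<exists>U. bitrade Q N U \<and> int (card U) = s) \<longleftrightarrow>
    (\<exists>n m :: nat. n \<ge> 1 \<and> N = n + m \<and>
      (n \<ge> 4 \<and> real_of_int s = 2 ^ m * (5 / 2 * 2 ^ n - 6) \<or>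
       n = 5 \<and> real_of_int s = 2 ^ m * (5 / 2 * 2 ^ 5 - 2) \<or>
       n = 3 \<and> real_of_int s = 2 ^ m * (5 / 2 * 2 ^ 3 - 2) \<or>
       n = 4 \<and> real_of_int s = 2 ^ m * (5 / 2 * 2 ^ 4)))"
proof -
  have "0 < s" using assms(3) by (smt (verit) zero_less_power)
  then obtain k where k: "s = int k" by (metis zero_less_imp_eq_int)
  obtain n where n: "N = Suc n" using assms(2) by (cases N) auto
  have "int (4 * 2 ^ n) < int k" "int k \<le> int (5 * 2 ^ n)" using assms(3,4) k n by simp_all
  then have bounds: "4 * 2 ^ n < k" "k \<le> 5 * 2 ^ n" by (simp_all only: of_nat_less_iff of_nat_le_iff)
  have "(\<exists>U. bitrade Q N U \<and> int (card U) = s) \<longleftrightarrow> (\<exists>f. signed Q N f \<and> card (supp Q N f) = k)"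
    unfolding bitrade_iff_signed[OF assms(1)] k of_nat_eq_iff by blast
  also have "\<dots> \<longleftrightarrow> spectrum N k"
    using supp_spectrum_le[OF assms(1), of n] spectrum_attained[OF assms(1)] bounds unfolding n by metis
  finally show ?thesis unfolding spectrum_iff_real by (simp only: k of_int_of_nat_eq)
qed

end
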